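(* Let $T>1$ and let $f\in L^2(-1,1)$ be such that $f(x)=0$ for all $x\in[a,b]\subseteq[-1,1]$. Then $P_N(f)\to0$ uniformly in all subintervals $[c,d]\subset(a,b)$ as $N\to\infty$.
   Context: Fix $T>1$. For each odd positive integer $N=2n+1$ let $\mathcal{H}_N=\mathrm{span}\{e^{\frac{i\pi}{T}kx}\}_{k=-n}^{n}\subset L^2(-1,1)$ and let $P_N$ be the orthogonal projection from $L^2(-1,1)$ onto $\mathcal{H}_N$. The limit $N\to\infty$ is through odd integers. *)

theory Defs
  imports "HOL-Analysis.Analysis"
begin

text \<open>Square-integrable complex functions on \<open>(-1,1)\<close>. Elements are represented by functions, not
  by equivalence classes modulo null sets; values outside \<open>(-1,1)\<close> play no role.\<close>

definition L2 :: "(real \<Rightarrow> complex) set" where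
  "L2 = {f \<in> borel_measurable (lebesgue_on {-1<..<1}).
           integrable (lebesgue_on {-1<..<1}) (\<lambda>x. (cmod (f x))\<^sup>2)}"

definition L2_inner :: "(real \<Rightarrow> complex) \<Rightarrow> (real \<Rightarrow> complex) \<Rightarrow> complex" where
  "L2_inner f g = (LINT x|lebesgue_on {-1<..<1}. f x * cnj (g x))"

text \<open>The complex span \<open>\<H>\<^sub>N\<close> of the exponentials with frequencies \<open>-n, \<dots>, n\<close>, where \<open>N = 2n + 1\<close>,
  so that \<open>n = N div 2\<close>; only odd \<open>N\<close> is meaningful. Its elements are kept as trigonometric
  polynomials on all of \<open>\<real>\<close>. Being analytic, they are determined by their classes in
  \<open>L\<^sup>2(-1,1)\<close>.\<close>

definition trig_space :: "real \<Rightarrow> nat \<Rightarrow> (real \<Rightarrow> complex) set" where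
  "trig_space T N =
     {p. \<exists>c :: int \<Rightarrow> complex.
           p = (\<lambda>x. \<Sum>k = - int (N div 2)..int (N div 2).
                  c k * exp (\<i> * of_real (pi / T * of_int k * x)))}"

text \<open>The orthogonal projection \<open>P\<^sub>N f\<close> is the element of \<open>\<H>\<^sub>N\<close> for which \<open>f - P\<^sub>N f\<close> is orthogonal
  to \<open>\<H>\<^sub>N\<close>. It exists and is unique for \<open>f\<close> in \<open>L2\<close> and \<open>T > 0\<close>: the space is finite-dimensional
  and a trigonometric polynomial vanishing almost everywhere on \<open>(-1,1)\<close> is zero.\<close>

definition orth_proj :: "real \<Rightarrow> nat \<Rightarrow> (real \<Rightarrow> complex) \<Rightarrow> (real \<Rightarrow> complex)" where
  "orth_proj T N f =
     (THE p. p \<in> trig_space T N \<and> (\<forall>q\<in>trig_space T N. L2_inner (\<lambda>x. f x - p x) q = 0))"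

end

theory Submission imports Defs begin

text \<open>
  Put \<open>\<theta> = \<pi>/(2T) < \<pi>/2\<close>, \<open>\<phi> = \<theta>x\<close> and \<open>\<sigma> = sin \<theta>\<close>, and let \<open>\<psi>(x)\<close> be given by \<open>sin \<psi> = sin \<phi> / \<sigma>\<close>. Then
  \<open>\<psi>\<close> maps \<open>[-1,1]\<close> increasingly onto \<open>[-\<pi>/2,\<pi>/2]\<close>, and \<open>cos 2\<phi>\<close> and \<open>cos 2\<psi>\<close> are affine functions of
  each other. So \<open>cos 2k\<phi>\<close> is a combination of the \<open>cos 2j\<psi>\<close> with \<open>j \<le> k\<close>, and \<open>sin 2(k+1)\<phi> / cos \<phi>\<close> is
  a combination of the \<open>sin (2j+1)\<psi>\<close> with \<open>j \<le> k\<close>, and conversely. The functions \<open>cos 2j\<psi>\<close> are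
  orthogonal on \<open>[-\<pi>/2,\<pi>/2]\<close>, and so are the functions \<open>sin (2j+1)\<psi>\<close>. Let \<open>p \<in> \<H>\<^sub>N\<close>.
  Applying the Dirichlet kernel of the first system to \<open>cos\<^sup>2 \<psi>\<close> times the even part of \<open>p\<close>, and that of
  the second system to \<open>cos\<^sup>2 \<psi> / cos \<phi>\<close> times the odd part, gives an explicit kernel \<open>Ker\<close> with
  \<open>\<integral> p(x) Ker(y,x) dx = lam(y) p(y)\<close> and \<open>lam(y) > 0\<close> on the open interval (\<open>Ker_reproduces\<close>).
  No orthogonal polynomials for the unweighted problem are needed.

  The function \<open>Ker(y,\<cdot>)\<close> is not in \<open>\<H>\<^sub>N\<close>. Replacing \<open>x\<close> by \<open>y\<close> in the weight of its even part,
  exchanging \<open>x\<close> and \<open>y\<close> in the weight of its odd part, and dropping the top frequencies yields an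
  element of \<open>\<H>\<^sub>N\<close>, \<open>trimmed_ker\<close>. The error is bounded uniformly in \<open>N\<close> and locally uniformly in \<open>y\<close>
  (\<open>Ker_minus_trimmed_ker_bounded\<close>), because the differences of the weights vanish at
  the singularities \<open>x = \<plusminus>y\<close> of the Dirichlet kernels. Since \<open>f - P\<^sub>N f\<close> is orthogonal to
  \<open>\<H>\<^sub>N\<close>, this gives (\<open>lam_orth_proj\<close>)

    \<open>lam(y) P\<^sub>N f(y) = \<integral> f(x) Ker(y,x) dx - \<integral> (f - P\<^sub>N f)(x) (Ker - trimmed_ker)(y,x) dx\<close>.

  The second integral tends to \<open>0\<close> uniformly because \<open>P\<^sub>N f\<close> tends to \<open>f\<close> in the mean
  (\<open>orth_proj_converges\<close>, from the Stone--Weierstrass theorem). In the first one only \<open>x\<close> outside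
  \<open>[a,b]\<close> contribute. There, up to bounded factors that depend only on \<open>N\<close> and \<open>y\<close>, \<open>Ker(y,x)\<close> is a sum
  of products of \<open>cos 2m\<psi>(x)\<close> or \<open>sin 2m\<psi>(x)\<close>, where \<open>N = 2m - 1\<close>, with coefficients that are jointly
  continuous in \<open>x\<close> and \<open>y \<in> [c,d]\<close>; the singularities at \<open>x = -y\<close> of the even and the odd
  kernel cancel. So it tends to \<open>0\<close> uniformly by a Riemann--Lebesgue lemma that is uniform over a
  compact set of coefficients (\<open>Ker_localization\<close>).
\<close>

section \<open>Square-integrable functions\<close>

abbreviation leb :: "real measure" where
  "leb \<equiv> lebesgue_on {-1<..<1}"

text \<open>The square of the norm of \<open>L\<^sup>2(-1,1)\<close>.\<close>

definition sqnorm :: "(real \<Rightarrow> complex) \<Rightarrow> real" where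
  "sqnorm f = (LINT x|leb. (cmod (f x))\<^sup>2)"

lemma finite_measure_leb: "finite_measure leb"
  by (rule finite_measure_lebesgue_on) (auto simp: fmeasurable_def emeasure_lborel_Ioo)

lemma measure_leb: "measure leb {-1<..<1} = 2"
  by (simp add: measure_restrict_space)

lemma borel_measurable_leb_continuous:
  fixes f :: "real \<Rightarrow> 'a::euclidean_space"
  assumes "continuous_on {-1<..<1} f"
  shows "f \<in> borel_measurable leb"
  using continuous_imp_measurable_on_sets_lebesgue[OF assms] by simp

lemma integrable_bounded_leb:
  fixes f :: "real \<Rightarrow> 'a::{banach, second_countable_topology}"
  assumes "f \<in> borel_measurable leb" "\<And>x. x \<in> {-1<..<1} \<Longrightarrow> norm (f x) \<le> B"
  shows "integrable leb f"
  by (rule finite_measure.integrable_const_bound[OF finite_measure_leb _ assms(1), of B])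
     (auto intro!: AE_I2 assms(2))

lemma L2_measurable [measurable_dest]: "f \<in> L2 \<Longrightarrow> f \<in> borel_measurable leb"
  by (simp add: L2_def)

lemma L2_integrable_sq: "f \<in> L2 \<Longrightarrow> integrable leb (\<lambda>x. (cmod (f x))\<^sup>2)"
  by (simp add: L2_def)

lemma L2_bounded:
  assumes "f \<in> borel_measurable leb" "\<And>x. x \<in> {-1<..<1} \<Longrightarrow> cmod (f x) \<le> B"
  shows "f \<in> L2"
proof -
  have "integrable leb (\<lambda>x. (cmod (f x))\<^sup>2)"
    by (rule integrable_bounded_leb[where B = "B\<^sup>2"])
       (use assms in \<open>auto intro!: power_mono\<close>)
  then show ?thesis using assms by (simp add: L2_def)
qed

lemma L2_cong:
  assumes "f \<in> L2" "\<And>x. x \<in> {-1<..<1} \<Longrightarrow> g x = f x"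
  shows "g \<in> L2"
proof -
  have "g \<in> borel_measurable leb"
    using L2_measurable[OF assms(1)] by (subst measurable_cong[where g = f]) (auto simp: assms(2))
  moreover have "integrable leb (\<lambda>x. (cmod (g x))\<^sup>2)"
    using L2_integrable_sq[OF assms(1)]
    by (subst Bochner_Integration.integrable_cong[where N = leb and g = "\<lambda>x. (cmod (f x))\<^sup>2"]) (auto simp: assms(2))
  ultimately show ?thesis by (simp add: L2_def)
qed

lemma L2_continuous:
  assumes "continuous_on {-1..1} f"
  shows "f \<in> L2"
proof -
  have "compact (f ` {-1..1})"
    using assms by (intro compact_continuous_image) auto
  then have "bounded (f ` {-1..1})"
    by (rule compact_imp_bounded)
  then obtain B where "\<forall>x\<in>{-1..1}. cmod (f x) \<le> B"
    unfolding bounded_iff by blast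
  then show ?thesis
    by (intro L2_bounded[where B = B] borel_measurable_leb_continuous)
       (auto intro: continuous_on_subset[OF assms])
qed

lemma cmod_add_squared_le: "(cmod (w + z))\<^sup>2 \<le> 2 * (cmod w)\<^sup>2 + 2 * (cmod z)\<^sup>2"
proof -
  have "(cmod (w + z))\<^sup>2 \<le> (cmod w + cmod z)\<^sup>2"
    by (intro power_mono norm_triangle_ineq) auto
  also have "\<dots> \<le> 2 * (cmod w)\<^sup>2 + 2 * (cmod z)\<^sup>2"
    using sum_squares_bound[of "cmod w" "cmod z"] by (simp add: power2_sum)
  finally show ?thesis .
qed

lemma L2_add:
  assumes f: "f \<in> L2" and g: "g \<in> L2"
  shows "(\<lambda>x. f x + g x) \<in> L2"
proof -
  have "integrable leb (\<lambda>x. (cmod (f x + g x))\<^sup>2)"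
  proof (rule Bochner_Integration.integrable_bound)
    show "integrable leb (\<lambda>x. 2 * (cmod (f x))\<^sup>2 + 2 * (cmod (g x))\<^sup>2)"
      using f g by (auto intro!: Bochner_Integration.integrable_add integrable_mult_right dest: L2_integrable_sq)
    show "AE x in leb. norm ((cmod (f x + g x))\<^sup>2) \<le> norm (2 * (cmod (f x))\<^sup>2 + 2 * (cmod (g x))\<^sup>2)"
      by (rule AE_I2) (use cmod_add_squared_le in simp)
  qed (use f g in measurable)
  moreover have "(\<lambda>x. f x + g x) \<in> borel_measurable leb"
    using f g by measurable
  ultimately show ?thesis by (simp add: L2_def)
qed

lemma L2_bounded_mult:
  assumes f: "f \<in> L2" and g: "g \<in> borel_measurable leb"
    and B: "\<And>x. x \<in> {-1<..<1} \<Longrightarrow> cmod (g x) \<le> B"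
  shows "(\<lambda>x. g x * f x) \<in> L2"
proof -
  have "integrable leb (\<lambda>x. (cmod (g x * f x))\<^sup>2)"
  proof (rule Bochner_Integration.integrable_bound)
    show "integrable leb (\<lambda>x. B\<^sup>2 * (cmod (f x))\<^sup>2)"
      using f by (auto intro!: integrable_mult_right dest: L2_integrable_sq)
    show "AE x in leb. norm ((cmod (g x * f x))\<^sup>2) \<le> norm (B\<^sup>2 * (cmod (f x))\<^sup>2)"
    proof (rule AE_I2)
      fix x assume "x \<in> space leb"
      then have "(cmod (g x))\<^sup>2 \<le> B\<^sup>2"
        by (intro power_mono B) auto
      then show "norm ((cmod (g x * f x))\<^sup>2) \<le> norm (B\<^sup>2 * (cmod (f x))\<^sup>2)"
        by (simp add: norm_mult power_mult_distrib mult_right_mono)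
    qed
  qed (use f g in measurable)
  moreover have "(\<lambda>x. g x * f x) \<in> borel_measurable leb"
    using f g by measurable
  ultimately show ?thesis by (simp add: L2_def)
qed

lemma L2_scale: "f \<in> L2 \<Longrightarrow> (\<lambda>x. c * f x) \<in> L2"
  by (rule L2_bounded_mult[where B = "cmod c"]) auto

lemma L2_diff: "f \<in> L2 \<Longrightarrow> g \<in> L2 \<Longrightarrow> (\<lambda>x. f x - g x) \<in> L2"
  using L2_add[of f "\<lambda>x. (-1) * g x"] L2_scale[of g "-1"] by simp

lemma L2_sum: "(\<And>k. k \<in> K \<Longrightarrow> f k \<in> L2) \<Longrightarrow> (\<lambda>x. \<Sum>k\<in>K. f k x) \<in> L2"
proof (induction K rule: infinite_finite_induct)
  case (insert k K)
  then show ?case by (auto intro!: L2_add)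
qed (auto intro: L2_continuous)

lemma L2_mult_integrable:
  assumes f: "f \<in> L2" and g: "g \<in> L2"
  shows "integrable leb (\<lambda>x. f x * g x)"
proof (rule Bochner_Integration.integrable_bound)
  show "integrable leb (\<lambda>x. (cmod (f x))\<^sup>2 + (cmod (g x))\<^sup>2)"
    using f g by (auto intro!: Bochner_Integration.integrable_add dest: L2_integrable_sq)
  show "AE x in leb. norm (f x * g x) \<le> norm ((cmod (f x))\<^sup>2 + (cmod (g x))\<^sup>2)"
  proof (rule AE_I2)
    fix x
    have "0 \<le> cmod (f x) * cmod (g x)" by simp
    then have "cmod (f x) * cmod (g x) \<le> (cmod (f x))\<^sup>2 + (cmod (g x))\<^sup>2"
      using sum_squares_bound[of "cmod (f x)" "cmod (g x)"] by linarith
    then show "norm (f x * g x) \<le> norm ((cmod (f x))\<^sup>2 + (cmod (g x))\<^sup>2)"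
      by (simp add: norm_mult)
  qed
qed (use f g in measurable)

lemma L2_cnj: "f \<in> L2 \<Longrightarrow> (\<lambda>x. cnj (f x)) \<in> L2"
proof -
  assume f: "f \<in> L2"
  then have [measurable]: "f \<in> borel_measurable leb" by (rule L2_measurable)
  have "(\<lambda>x. cnj (f x)) \<in> borel_measurable leb"
    by (rule measurable_compose[OF _ borel_measurable_continuous_onI]) (auto intro: continuous_intros)
  with f show ?thesis by (simp add: L2_def)
qed

lemma L2_inner_integrable: "f \<in> L2 \<Longrightarrow> g \<in> L2 \<Longrightarrow> integrable leb (\<lambda>x. f x * cnj (g x))"
  by (intro L2_mult_integrable L2_cnj)

lemma L2_integrable: "f \<in> L2 \<Longrightarrow> integrable leb f"
  using L2_mult_integrable[of f "\<lambda>_. 1"] L2_continuous[of "\<lambda>_. 1"] by simp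

lemma L2_inner_diff_left:
  "f \<in> L2 \<Longrightarrow> g \<in> L2 \<Longrightarrow> h \<in> L2 \<Longrightarrow> L2_inner (\<lambda>x. f x - g x) h = L2_inner f h - L2_inner g h"
  unfolding L2_inner_def
  by (simp add: left_diff_distrib Bochner_Integration.integral_diff L2_inner_integrable)

lemma L2_inner_diff_right:
  "f \<in> L2 \<Longrightarrow> g \<in> L2 \<Longrightarrow> h \<in> L2 \<Longrightarrow> L2_inner h (\<lambda>x. f x - g x) = L2_inner h f - L2_inner h g"
  unfolding L2_inner_def
  by (simp add: right_diff_distrib Bochner_Integration.integral_diff L2_inner_integrable)

lemma L2_inner_scale_left: "L2_inner (\<lambda>x. c * f x) h = c * L2_inner f h"
  unfolding L2_inner_def by (simp add: mult.assoc)

lemma L2_inner_scale_right: "L2_inner h (\<lambda>x. c * f x) = cnj c * L2_inner h f"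
proof -
  have "(\<lambda>x. h x * cnj (c * f x)) = (\<lambda>x. cnj c * (h x * cnj (f x)))" by (simp add: algebra_simps)
  then show ?thesis unfolding L2_inner_def by simp
qed

lemma L2_inner_sum_right:
  assumes "h \<in> L2" "\<And>k. k \<in> K \<Longrightarrow> g k \<in> L2"
  shows "L2_inner h (\<lambda>x. \<Sum>k\<in>K. c k * g k x) = (\<Sum>k\<in>K. cnj (c k) * L2_inner h (g k))"
proof -
  have "L2_inner h (\<lambda>x. \<Sum>k\<in>K. c k * g k x) = (LINT x|leb. (\<Sum>k\<in>K. h x * cnj (c k * g k x)))"
    unfolding L2_inner_def by (simp add: sum_distrib_left)
  also have "\<dots> = (\<Sum>k\<in>K. LINT x|leb. h x * cnj (c k * g k x))"
    by (rule Bochner_Integration.integral_sum) (intro L2_inner_integrable assms L2_scale)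
  also have "\<dots> = (\<Sum>k\<in>K. cnj (c k) * L2_inner h (g k))"
    by (intro sum.cong refl) (use L2_inner_scale_right in \<open>simp add: L2_inner_def\<close>)
  finally show ?thesis .
qed

lemma L2_inner_self: "L2_inner f f = of_real (sqnorm f)"
proof -
  have "(\<lambda>x. f x * cnj (f x)) = (\<lambda>x. of_real ((cmod (f x))\<^sup>2))"
    by (simp only: complex_norm_square)
  then show ?thesis unfolding L2_inner_def sqnorm_def by (simp only: integral_complex_of_real)
qed

lemma sqnorm_nonneg: "0 \<le> sqnorm f"
  unfolding sqnorm_def by (rule Bochner_Integration.integral_nonneg) auto

lemma sqnorm_zero_AE:
  assumes "f \<in> L2" "sqnorm f = 0"
  shows "AE x in leb. f x = 0"
proof -
  have "AE x in leb. (cmod (f x))\<^sup>2 = 0"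
    using assms by (subst integral_nonneg_eq_0_iff_AE[symmetric]) (auto simp: sqnorm_def L2_integrable_sq)
  then show ?thesis by simp
qed

lemma L2_inner_AE_zero_right:
  assumes "AE x in leb. g x = 0"
  shows "L2_inner f g = 0"
  unfolding L2_inner_def by (rule integral_eq_zero_AE) (use assms in \<open>auto elim: eventually_mono\<close>)

lemma sqnorm_add:
  assumes f: "f \<in> L2" and g: "g \<in> L2" and "L2_inner f g = 0"
  shows "sqnorm (\<lambda>x. f x + g x) = sqnorm f + sqnorm g"
proof -
  have *: "(\<lambda>x. (cmod (f x + g x))\<^sup>2) = (\<lambda>x. (cmod (f x))\<^sup>2 + 2 * Re (f x * cnj (g x)) + (cmod (g x))\<^sup>2)"
    by (rule ext) (simp add: cmod_power2, simp add: power2_eq_square algebra_simps)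
  have "(LINT x|leb. Re (f x * cnj (g x))) = 0"
    using assms(3) by (subst integral_Re) (auto simp: L2_inner_def intro!: L2_inner_integrable f g)
  moreover have "integrable leb (\<lambda>x. Re (f x * cnj (g x)))"
    by (intro integrable_Re L2_inner_integrable f g)
  ultimately show ?thesis
    unfolding sqnorm_def * using f g
    by (simp add: Bochner_Integration.integral_add L2_integrable_sq del: times_complex.sel)
qed

lemma sqnorm_add_le:
  assumes f: "f \<in> L2" and g: "g \<in> L2"
  shows "sqnorm (\<lambda>x. f x + g x) \<le> 2 * sqnorm f + 2 * sqnorm g"
proof -
  have "sqnorm (\<lambda>x. f x + g x) \<le> (LINT x|leb. 2 * (cmod (f x))\<^sup>2 + 2 * (cmod (g x))\<^sup>2)"
    unfolding sqnorm_def
  proof (rule Bochner_Integration.integral_mono)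
    show "integrable leb (\<lambda>x. (cmod (f x + g x))\<^sup>2)"
      by (rule L2_integrable_sq[OF L2_add[OF f g]])
    show "integrable leb (\<lambda>x. 2 * (cmod (f x))\<^sup>2 + 2 * (cmod (g x))\<^sup>2)"
      using f g by (auto intro!: Bochner_Integration.integrable_add integrable_mult_right dest: L2_integrable_sq)
    show "(cmod (f x + g x))\<^sup>2 \<le> 2 * (cmod (f x))\<^sup>2 + 2 * (cmod (g x))\<^sup>2" for x
      by (rule cmod_add_squared_le)
  qed
  also have "\<dots> = 2 * sqnorm f + 2 * sqnorm g"
    unfolding sqnorm_def using f g by (simp add: Bochner_Integration.integral_add L2_integrable_sq)
  finally show ?thesis .
qed

lemma L2_mult_continuous_support:
  fixes h :: "real \<Rightarrow> real"
  assumes f: "f \<in> L2" and S: "compact S" and h: "continuous_on S h"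
    and f0: "\<And>x. x \<in> {-1<..<1} - S \<Longrightarrow> f x = 0"
  shows "(\<lambda>x. of_real (h x) * f x) \<in> L2"
proof -
  have "S \<in> sets borel" using compact_imp_closed[OF S] by (rule borel_closed)
  then have "(\<lambda>x. indicator S x *\<^sub>R h x) \<in> borel_measurable borel"
    using h by (rule borel_measurable_continuous_on_indicator)
  then have "(\<lambda>x. indicator S x *\<^sub>R h x) \<in> borel_measurable lebesgue"
    by (intro measurable_completion) simp
  then have m: "(\<lambda>x. indicator S x *\<^sub>R h x) \<in> borel_measurable leb" by (rule measurable_restrict_space1)
  have "bounded (h ` S)" by (intro compact_imp_bounded compact_continuous_image h S)
  then obtain B where B: "\<forall>x\<in>S. \<bar>h x\<bar> \<le> B" unfolding bounded_iff by auto
  have "(\<lambda>x. complex_of_real (indicator S x *\<^sub>R h x) * f x) \<in> L2"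
  proof (rule L2_bounded_mult[OF f])
    show "(\<lambda>x. complex_of_real (indicator S x *\<^sub>R h x)) \<in> borel_measurable leb"
      using m by measurable
    show "cmod (of_real (indicator S x *\<^sub>R h x)) \<le> max B 0" for x
      using B by (cases "x \<in> S") (auto simp: le_max_iff_disj)
  qed
  then show ?thesis
    by (rule L2_cong) (use f0 in \<open>auto simp: indicator_def\<close>)
qed

text \<open>The bound of the \<open>L\<^sup>1\<close> norm by the \<open>L\<^sup>2\<close> norm on an interval of finite length, in a form
  that avoids square roots.\<close>

lemma integral_mult_bounded_small:
  assumes f: "f \<in> L2" and g: "g \<in> borel_measurable leb"
    and B: "\<And>x. x \<in> {-1<..<1} \<Longrightarrow> cmod (g x) \<le> B"
    and \<delta>: "\<delta> > 0" "sqnorm f \<le> \<delta>\<^sup>2"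
  shows "cmod (LINT x|leb. f x * g x) \<le> 2 * B * \<delta>"
proof -
  have B0: "0 \<le> B" using order_trans[OF norm_ge_zero B[of 0]] by simp
  have "cmod (LINT x|leb. f x * g x) \<le> (LINT x|leb. B * (((cmod (f x))\<^sup>2 / \<delta> + \<delta>) / 2))"
  proof (rule Bochner_Integration.integral_norm_bound_integral)
    show "integrable leb (\<lambda>x. f x * g x)"
      by (rule L2_mult_integrable[OF f L2_bounded[OF g B]])
    show "integrable leb (\<lambda>x. B * (((cmod (f x))\<^sup>2 / \<delta> + \<delta>) / 2))"
      using f finite_measure_leb
      by (intro integrable_mult_right integrable_divide Bochner_Integration.integrable_add L2_integrable_sq
          finite_measure.integrable_const) auto
    fix x assume "x \<in> space leb"
    then have "cmod (f x * g x) \<le> B * cmod (f x)"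
      using mult_left_mono[OF B[of x] norm_ge_zero[of "f x"]] by (simp add: norm_mult mult.commute)
    also have "2 * cmod (f x) * \<delta> \<le> (cmod (f x))\<^sup>2 + \<delta>\<^sup>2"
      by (rule sum_squares_bound)
    then have "cmod (f x) \<le> ((cmod (f x))\<^sup>2 / \<delta> + \<delta>) / 2"
      using \<delta> by (simp add: field_simps power2_eq_square)
    then have "B * cmod (f x) \<le> B * (((cmod (f x))\<^sup>2 / \<delta> + \<delta>) / 2)"
      using B0 by (rule mult_left_mono)
    finally show "cmod (f x * g x) \<le> B * (((cmod (f x))\<^sup>2 / \<delta> + \<delta>) / 2)" .
  qed
  also have "\<dots> = B * ((sqnorm f / \<delta> + 2 * \<delta>) / 2)"
    using f finite_measure.integrable_const[OF finite_measure_leb, of \<delta>]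
    by (simp add: Bochner_Integration.integral_add L2_integrable_sq sqnorm_def measure_leb)
  also have "\<dots> \<le> B * (2 * \<delta>)"
  proof (rule mult_left_mono[OF _ B0])
    have "sqnorm f / \<delta> \<le> \<delta>" using \<delta> by (simp add: field_simps power2_eq_square)
    then show "(sqnorm f / \<delta> + 2 * \<delta>) / 2 \<le> 2 * \<delta>" using \<delta> by simp
  qed
  finally show ?thesis by (simp add: mult_ac)
qed

section \<open>Orthogonal projection onto a finite-dimensional span\<close>

text \<open>The generators need not be linearly independent. The induction step is one step of the
  Gram--Schmidt process.\<close>

lemma projection_exists:
  assumes "finite K" and g: "\<And>k. k \<in> K \<Longrightarrow> g k \<in> L2" and f: "f \<in> L2"
  shows "\<exists>c. \<forall>j\<in>K. L2_inner (\<lambda>x. f x - (\<Sum>k\<in>K. c k * g k x)) (g j) = 0"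
  using assms
proof (induction K arbitrary: f rule: finite_induct)
  case empty
  then show ?case by simp
next
  case (insert i K)
  have gK: "\<And>k. k \<in> K \<Longrightarrow> g k \<in> L2" and gi: "g i \<in> L2"
    using insert.prems by auto
  obtain c where c: "\<And>j. j \<in> K \<Longrightarrow> L2_inner (\<lambda>x. f x - (\<Sum>k\<in>K. c k * g k x)) (g j) = 0"
    using insert.IH[OF gK \<open>f \<in> L2\<close>] by blast
  obtain d where d: "\<And>j. j \<in> K \<Longrightarrow> L2_inner (\<lambda>x. g i x - (\<Sum>k\<in>K. d k * g k x)) (g j) = 0"
    using insert.IH[OF gK gi] by blast
  define r where "r = (\<lambda>x. f x - (\<Sum>k\<in>K. c k * g k x))"
  define s where "s = (\<lambda>x. g i x - (\<Sum>k\<in>K. d k * g k x))"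
  have sumL2: "(\<lambda>x. \<Sum>k\<in>K. a k * g k x) \<in> L2" for a
    by (intro L2_sum L2_scale gK)
  have r: "r \<in> L2" and s: "s \<in> L2"
    unfolding r_def s_def by (intro L2_diff sumL2 gi \<open>f \<in> L2\<close>)+
  have inner_i: "L2_inner h (g i) = L2_inner h s" if "h \<in> L2" "\<And>j. j \<in> K \<Longrightarrow> L2_inner h (g j) = 0" for h
    unfolding s_def using that by (simp add: L2_inner_diff_right gi sumL2 L2_inner_sum_right gK)
  \<comment> \<open>If \<open>g i\<close> depends on the other generators, then \<open>s = 0\<close> almost everywhere and \<open>r\<close> is already
    orthogonal to it; the default value \<open>0\<close> of the quotient serves this case.\<close>
  define t where "t = L2_inner r s / L2_inner s s"
  have ts: "t * L2_inner s s = L2_inner r s"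
  proof (cases "L2_inner s s = 0")
    case True
    then have "AE x in leb. s x = 0"
      using sqnorm_zero_AE[OF s] by (simp add: L2_inner_self)
    then show ?thesis using True by (simp add: L2_inner_AE_zero_right)
  qed (simp add: t_def)
  define c' where "c' = (\<lambda>k. if k = i then t else c k - t * d k)"
  have "(\<Sum>k\<in>insert i K. c' k * g k x) = t * g i x + (\<Sum>k\<in>K. (c k - t * d k) * g k x)" for x
  proof -
    have "(\<Sum>k\<in>K. c' k * g k x) = (\<Sum>k\<in>K. (c k - t * d k) * g k x)"
      using insert.hyps by (intro sum.cong) (auto simp: c'_def)
    then show ?thesis using insert.hyps by (simp add: c'_def)
  qed
  then have p: "(\<lambda>x. f x - (\<Sum>k\<in>insert i K. c' k * g k x)) = (\<lambda>x. r x - t * s x)"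
    by (intro ext)
       (simp only:, simp add: r_def s_def left_diff_distrib right_diff_distrib sum_subtractf
          sum_distrib_left mult.assoc)
  have perp: "L2_inner (\<lambda>x. r x - t * s x) (g j) = 0" if "j \<in> K" for j
    using that c d r s gK by (simp add: L2_inner_diff_left L2_scale L2_inner_scale_left flip: r_def s_def)
  have "L2_inner (\<lambda>x. r x - t * s x) (g i) = L2_inner (\<lambda>x. r x - t * s x) s"
    by (rule inner_i) (use r s perp in \<open>auto intro: L2_diff L2_scale\<close>)
  also have "\<dots> = 0"
    using r s ts by (simp add: L2_inner_diff_left L2_scale L2_inner_scale_left)
  finally show ?case unfolding p[symmetric] using perp p by (intro exI[of _ c']) auto
qed


section \<open>Trigonometric polynomials and their density\<close>

text \<open>The exponential with frequency \<open>k\<close>.\<close>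

definition wave :: "real \<Rightarrow> int \<Rightarrow> real \<Rightarrow> complex" where
  "wave T k x = exp (\<i> * of_real (pi / T * of_int k * x))"

lemma wave_cis: "wave T k x = cis (pi / T * of_int k * x)"
  by (simp add: wave_def cis_conv_exp)

lemma wave_mult: "wave T j x * wave T k x = wave T (j + k) x"
  by (simp add: wave_cis cis_mult algebra_simps)

lemma trig_space_odd:
  "trig_space T (2 * n + 1) = {p. \<exists>c. p = (\<lambda>x. \<Sum>k = - int n..int n. c k * wave T k x)}"
  unfolding trig_space_def wave_def by simp

lemma wave_in_trig_space:
  assumes "\<bar>k\<bar> \<le> int n"
  shows "wave T k \<in> trig_space T (2 * n + 1)"
proof -
  have "wave T k = (\<lambda>x. \<Sum>j = - int n..int n. (if j = k then 1 else 0) * wave T j x)"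
    using assms by (intro ext) (auto simp: if_distrib[of "\<lambda>z. z * _"] sum.delta cong: if_cong)
  then show ?thesis unfolding trig_space_odd by (intro CollectI exI)
qed

lemma trig_space_add:
  assumes "p \<in> trig_space T (2 * n + 1)" "q \<in> trig_space T (2 * n + 1)"
  shows "(\<lambda>x. p x + q x) \<in> trig_space T (2 * n + 1)"
proof -
  obtain c d where "p = (\<lambda>x. \<Sum>k = - int n..int n. c k * wave T k x)"
    "q = (\<lambda>x. \<Sum>k = - int n..int n. d k * wave T k x)"
    using assms unfolding trig_space_odd by blast
  then have "(\<lambda>x. p x + q x) = (\<lambda>x. \<Sum>k = - int n..int n. (c k + d k) * wave T k x)"
    by (simp add: distrib_right sum.distrib)
  then show ?thesis unfolding trig_space_odd by (intro CollectI exI)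
qed

lemma trig_space_scale:
  assumes "p \<in> trig_space T (2 * n + 1)"
  shows "(\<lambda>x. a * p x) \<in> trig_space T (2 * n + 1)"
proof -
  obtain c where "p = (\<lambda>x. \<Sum>k = - int n..int n. c k * wave T k x)"
    using assms unfolding trig_space_odd by blast
  then have "(\<lambda>x. a * p x) = (\<lambda>x. \<Sum>k = - int n..int n. (a * c k) * wave T k x)"
    by (simp add: sum_distrib_left mult.assoc)
  then show ?thesis unfolding trig_space_odd by (intro CollectI exI)
qed

lemma trig_space_zero: "(\<lambda>x. 0) \<in> trig_space T (2 * n + 1)"
  using trig_space_scale[OF wave_in_trig_space[of 0 n T], of 0] by simp

lemma trig_space_diff:
  assumes "p \<in> trig_space T (2 * n + 1)" "q \<in> trig_space T (2 * n + 1)"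
  shows "(\<lambda>x. p x - q x) \<in> trig_space T (2 * n + 1)"
  using trig_space_add[OF assms(1) trig_space_scale[OF assms(2), of "-1"]] by simp

lemma trig_space_sum:
  assumes "\<And>k. k \<in> K \<Longrightarrow> p k \<in> trig_space T (2 * n + 1)"
  shows "(\<lambda>x. \<Sum>k\<in>K. p k x) \<in> trig_space T (2 * n + 1)"
  using assms by (induction K rule: infinite_finite_induct) (auto simp del: One_nat_def intro!: trig_space_zero trig_space_add)

lemma trig_space_mono:
  assumes "p \<in> trig_space T (2 * m + 1)" "m \<le> n"
  shows "p \<in> trig_space T (2 * n + 1)"
proof -
  obtain c where "p = (\<lambda>x. \<Sum>k = - int m..int m. c k * wave T k x)"
    using assms(1) unfolding trig_space_odd by blast
  moreover have "(\<lambda>x. \<Sum>k = - int m..int m. c k * wave T k x) \<in> trig_space T (2 * n + 1)"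
    using assms(2) by (intro trig_space_sum trig_space_scale wave_in_trig_space) auto
  ultimately show ?thesis by simp
qed

lemma trig_space_mult:
  assumes "p \<in> trig_space T (2 * m + 1)" "q \<in> trig_space T (2 * n + 1)"
  shows "(\<lambda>x. p x * q x) \<in> trig_space T (2 * (m + n) + 1)"
proof -
  obtain c d where pq: "p = (\<lambda>x. \<Sum>k = - int m..int m. c k * wave T k x)"
    "q = (\<lambda>x. \<Sum>k = - int n..int n. d k * wave T k x)"
    using assms unfolding trig_space_odd by blast
  have "(\<lambda>x. p x * q x) = (\<lambda>x. \<Sum>j = - int m..int m. \<Sum>k = - int n..int n. (c j * d k) * wave T (j + k) x)"
    unfolding pq sum_product by (simp add: mult_ac flip: wave_mult)
  moreover have "\<dots> \<in> trig_space T (2 * (m + n) + 1)"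
    by (intro trig_space_sum trig_space_scale wave_in_trig_space) auto
  ultimately show ?thesis by simp
qed

lemma cos_in_trig_space:
  assumes "k \<le> n"
  shows "(\<lambda>x. of_real (cos (pi / T * real k * x))) \<in> trig_space T (2 * n + 1)"
proof -
  have "(\<lambda>x. of_real (cos (pi / T * real k * x))) = (\<lambda>x. (1/2) * wave T (int k) x + (1/2) * wave T (- int k) x)"
    by (rule ext) (simp add: wave_cis complex_eq_iff)
  also have "\<dots> \<in> trig_space T (2 * n + 1)"
    using assms by (intro trig_space_add trig_space_scale wave_in_trig_space) auto
  finally show ?thesis .
qed

lemma sin_in_trig_space:
  assumes "k \<le> n"
  shows "(\<lambda>x. of_real (sin (pi / T * real k * x))) \<in> trig_space T (2 * n + 1)"
proof -
  have "(\<lambda>x. of_real (sin (pi / T * real k * x))) = (\<lambda>x. (-\<i>/2) * wave T (int k) x + (\<i>/2) * wave T (- int k) x)"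
    by (rule ext) (simp add: wave_cis complex_eq_iff)
  also have "\<dots> \<in> trig_space T (2 * n + 1)"
    using assms by (intro trig_space_add trig_space_scale wave_in_trig_space) auto
  finally show ?thesis .
qed

lemma continuous_on_wave: "continuous_on S (wave T k)"
  unfolding wave_def by (intro continuous_intros)

lemma trig_space_continuous:
  assumes "p \<in> trig_space T (2 * n + 1)"
  shows "continuous_on S p"
proof -
  obtain c where "p = (\<lambda>x. \<Sum>k = - int n..int n. c k * wave T k x)"
    using assms unfolding trig_space_odd by blast
  then show ?thesis by (auto intro!: continuous_intros continuous_on_wave)
qed

lemma trig_space_L2: "p \<in> trig_space T (2 * n + 1) \<Longrightarrow> p \<in> L2"
  by (intro L2_continuous trig_space_continuous)

text \<open>The condition \<open>T > 1\<close> enters here: functions of period \<open>2T\<close> separate the points of \<open>[-1,1]\<close>,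
  including the two end points.\<close>

lemma sin_cos_separate:
  assumes T: "T > 1" and xy: "x \<in> {-1..1}" "y \<in> {-1..1}"
    and "sin (pi / T * x) = sin (pi / T * y)" "cos (pi / T * x) = cos (pi / T * y)"
  shows "x = y"
proof (rule ccontr)
  assume "x \<noteq> y"
  obtain k :: int where "pi / T * x = pi / T * y + 2 * pi * k"
    using assms sin_cos_eq_iff by blast
  then have "pi * (x - y) = pi * (2 * T * k)"
    using T by (simp add: field_simps)
  then have eq: "x - y = 2 * T * k" by simp
  then have "k \<noteq> 0" using \<open>x \<noteq> y\<close> by auto
  then have "1 \<le> \<bar>real_of_int k\<bar>" by linarith
  then have "2 * T \<le> \<bar>x - y\<bar>" using T by (simp add: eq abs_mult)
  then show False using xy T by (auto simp: abs_if split: if_splits)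
qed

lemma trig_approx_real:
  assumes T: "T > 1" and g: "continuous_on {-1..1} (g :: real \<Rightarrow> real)" and e: "e > 0"
  shows "\<exists>n. \<exists>p\<in>trig_space T (2 * n + 1). \<forall>x\<in>{-1..1}. cmod (of_real (g x) - p x) < e"
proof -
  define R where "R = {f :: real \<Rightarrow> real. \<exists>n. (\<lambda>x. complex_of_real (f x)) \<in> trig_space T (2 * n + 1)}"
  interpret function_ring_on R "{-1..1 :: real}"
  proof unfold_locales
    show "compact {-1..1 :: real}" by simp
  next
    fix f assume "f \<in> R"
    then obtain n where "(\<lambda>x. complex_of_real (f x)) \<in> trig_space T (2 * n + 1)" by (auto simp: R_def)
    from continuous_on_Re[OF trig_space_continuous[OF this]] show "continuous_on {-1..1} f" by simp
  next
    fix f g assume "f \<in> R" "g \<in> R"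
    then obtain m n where mn: "(\<lambda>x. complex_of_real (f x)) \<in> trig_space T (2 * m + 1)"
      "(\<lambda>x. complex_of_real (g x)) \<in> trig_space T (2 * n + 1)" by (auto simp: R_def)
    from trig_space_add[OF trig_space_mono[OF mn(1), of "m + n"] trig_space_mono[OF mn(2), of "m + n"]]
    show "(\<lambda>x. f x + g x) \<in> R" unfolding R_def by (intro CollectI exI[of _ "m + n"]) simp
    from trig_space_mult[OF mn]
    show "(\<lambda>x. f x * g x) \<in> R" unfolding R_def by (intro CollectI exI[of _ "m + n"]) simp
  next
    fix c :: real
    show "(\<lambda>_. c) \<in> R"
      unfolding R_def using trig_space_scale[OF wave_in_trig_space[of 0 0 T], of "of_real c"]
      by (intro CollectI exI[of _ 0]) (simp add: wave_cis)
  next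
    fix x y :: real assume xy: "x \<in> {-1..1}" "y \<in> {-1..1}" "x \<noteq> y"
    have R: "(\<lambda>x. sin (pi / T * x)) \<in> R" "(\<lambda>x. cos (pi / T * x)) \<in> R"
      unfolding R_def using sin_in_trig_space[of 1 1 T] cos_in_trig_space[of 1 1 T]
      by (intro CollectI exI[of _ 1], simp)+
    have "\<not> (sin (pi / T * x) = sin (pi / T * y) \<and> cos (pi / T * x) = cos (pi / T * y))"
      using sin_cos_separate[OF T xy(1,2)] xy(3) by blast
    then consider "sin (pi / T * x) \<noteq> sin (pi / T * y)" | "cos (pi / T * x) \<noteq> cos (pi / T * y)"
      by argo
    then show "\<exists>f\<in>R. f x \<noteq> f y"
    proof cases
      case 1
      then show ?thesis by (rule bexI[OF _ R(1)])
    next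
      case 2
      then show ?thesis by (rule bexI[OF _ R(2)])
    qed
  qed
  obtain f where f: "f \<in> R" "\<And>x. x \<in> {-1..1} \<Longrightarrow> \<bar>g x - f x\<bar> < e"
    using Stone_Weierstrass_basic[OF g e] by blast
  then obtain n where "(\<lambda>x. complex_of_real (f x)) \<in> trig_space T (2 * n + 1)" by (auto simp: R_def)
  moreover have "cmod (of_real (g x) - of_real (f x)) < e" if "x \<in> {-1..1}" for x
    using f(2)[OF that] by (metis norm_of_real of_real_diff)
  ultimately show ?thesis by (intro exI[of _ n] bexI[of _ "\<lambda>x. complex_of_real (f x)"]) auto
qed

lemma trig_approx_continuous:
  assumes T: "T > 1" and g: "continuous_on {-1..1} (g :: real \<Rightarrow> complex)" and e: "e > 0"
  shows "\<exists>n. \<exists>p\<in>trig_space T (2 * n + 1). \<forall>x\<in>{-1..1}. cmod (g x - p x) < e"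
proof -
  obtain m p where p: "p \<in> trig_space T (2 * m + 1)"
    "\<forall>x\<in>{-1..1}. cmod (of_real (Re (g x)) - p x) < e / 2"
    using trig_approx_real[OF T continuous_on_Re[OF g], of "e / 2"] e by auto
  obtain n q where q: "q \<in> trig_space T (2 * n + 1)"
    "\<forall>x\<in>{-1..1}. cmod (of_real (Im (g x)) - q x) < e / 2"
    using trig_approx_real[OF T continuous_on_Im[OF g], of "e / 2"] e by auto
  have "(\<lambda>x. p x + \<i> * q x) \<in> trig_space T (2 * (m + n) + 1)"
    by (intro trig_space_add trig_space_scale trig_space_mono[OF p(1)] trig_space_mono[OF q(1)]) auto
  moreover have "cmod (g x - (p x + \<i> * q x)) < e" if "x \<in> {-1..1}" for x
  proof -
    have "g x - (p x + \<i> * q x) = (of_real (Re (g x)) - p x) + \<i> * (of_real (Im (g x)) - q x)"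
      using complex_eq[of "g x"] by (simp add: algebra_simps)
    also have "cmod \<dots> \<le> cmod (of_real (Re (g x)) - p x) + cmod (\<i> * (of_real (Im (g x)) - q x))"
      by (rule norm_triangle_ineq)
    also have "\<dots> < e / 2 + e / 2"
      using p(2) q(2) that by (intro add_strict_mono) (auto simp: norm_mult)
    finally show ?thesis by simp
  qed
  ultimately show ?thesis by (intro exI[of _ "m + n"] bexI[of _ "\<lambda>x. p x + \<i> * q x"]) auto
qed

text \<open>The values of \<open>f\<close> are projected onto large discs.\<close>

lemma L2_approx_bounded:
  assumes f: "f \<in> L2" and e: "e > 0"
  shows "\<exists>g\<in>L2. \<exists>B>0. (\<forall>x. cmod (g x) \<le> B) \<and> sqnorm (\<lambda>x. f x - g x) < e"
proof -
  define cl where "cl k = (closest_point (cball 0 (real k)) :: complex \<Rightarrow> complex)" for k :: nat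
  have [simp]: "cmod (cl k z) \<le> real k" for k z
    using closest_point_in_set[of "cball 0 (real k)" z] by (auto simp: cl_def)
  have cont: "continuous_on UNIV (cl k)" for k
    unfolding cl_def by (intro continuous_on_closest_point) auto
  have meas: "(\<lambda>x. cl k (f x)) \<in> borel_measurable leb" for k
    by (rule measurable_compose[OF L2_measurable[OF f] borel_measurable_continuous_onI[OF cont]])
  have L2cl: "(\<lambda>x. cl k (f x)) \<in> L2" for k
    by (rule L2_bounded[OF meas, where B = "real k"]) simp
  have le: "cmod (z - cl k z) \<le> cmod z" for k z
    using closest_point_le[of "cball 0 (real k)" 0 z] by (simp add: cl_def dist_norm)
  have "(\<lambda>k. LINT x|leb. (cmod (f x - cl k (f x)))\<^sup>2) \<longlonglongrightarrow> (LINT x|leb. 0)"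
  proof (rule integral_dominated_convergence)
    show "integrable leb (\<lambda>x. (cmod (f x))\<^sup>2)" by (rule L2_integrable_sq[OF f])
    show "(\<lambda>x. (cmod (f x - cl k (f x)))\<^sup>2) \<in> borel_measurable leb" for k
      using L2_integrable_sq[OF L2_diff[OF f L2cl]] by (rule borel_measurable_integrable)
    show "AE x in leb. norm ((cmod (f x - cl k (f x)))\<^sup>2) \<le> (cmod (f x))\<^sup>2" for k
      by (rule AE_I2) (auto intro!: power_mono le)
    show "AE x in leb. (\<lambda>k. (cmod (f x - cl k (f x)))\<^sup>2) \<longlonglongrightarrow> 0"
    proof (rule AE_I2)
      fix x
      obtain K where "cmod (f x) \<le> real K" using real_arch_simple by blast
      then have "cl k (f x) = f x" if "k \<ge> K" for k
        using that unfolding cl_def by (intro closest_point_self) auto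
      then have "\<forall>\<^sub>F k in sequentially. (cmod (f x - cl k (f x)))\<^sup>2 = 0"
        unfolding eventually_sequentially by (intro exI[of _ K]) auto
      then show "(\<lambda>k. (cmod (f x - cl k (f x)))\<^sup>2) \<longlonglongrightarrow> 0" by (rule tendsto_eventually)
    qed
  qed simp
  then have "(\<lambda>k. sqnorm (\<lambda>x. f x - cl k (f x))) \<longlonglongrightarrow> 0" by (simp add: sqnorm_def)
  then have "\<forall>\<^sub>F k in sequentially. sqnorm (\<lambda>x. f x - cl k (f x)) < e"
    using e by (rule order_tendstoD)
  then obtain k where "sqnorm (\<lambda>x. f x - cl k (f x)) < e"
    by (auto simp: eventually_sequentially)
  moreover have "cmod (cl k (f x)) \<le> real k + 1" for x
    using order_trans[of "cmod (cl k (f x))" "real k" "real k + 1"] by simp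
  ultimately show ?thesis
    using L2cl[of k] by (intro bexI[of _ "\<lambda>x. cl k (f x)"] exI[of _ "real k + 1"]) auto
qed

text \<open>A measurable function is a limit almost everywhere of continuous functions; after projecting
  their values onto a disc that contains the values of \<open>f\<close>, dominated convergence applies.\<close>

lemma L2_approx_continuous_of_bounded:
  assumes f: "f \<in> L2" and B: "B > 0" "\<And>x. cmod (f x) \<le> B" and e: "e > 0"
  shows "\<exists>g. continuous_on UNIV g \<and> sqnorm (\<lambda>x. f x - g x) < e"
proof -
  define cl where "cl = (closest_point (cball 0 B) :: complex \<Rightarrow> complex)"
  have cl_le: "cmod (cl z) \<le> B" for z
    using closest_point_in_set[of "cball 0 B" z] B by (auto simp: cl_def)
  have cont: "continuous_on UNIV cl"
    unfolding cl_def using B by (intro continuous_on_closest_point) auto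
  have cl_f: "cl (f x) = f x" for x
    unfolding cl_def by (rule closest_point_self) (use B in auto)
  have "f measurable_on {-1<..<1}"
    using L2_measurable[OF f] by (simp add: measurable_on_iff_borel_measurable)
  then obtain N g where N: "negligible N" and g: "\<And>n. continuous_on UNIV (g n)"
    and lim: "\<And>x. x \<notin> N \<Longrightarrow> (\<lambda>n. g n x) \<longlonglongrightarrow> (if x \<in> {-1<..<1} then f x else 0)"
    unfolding measurable_on_def by blast
  have cg: "continuous_on UNIV (\<lambda>x. cl (g n x))" for n
    using continuous_on_compose2[OF cont g] by auto
  have gL2: "(\<lambda>x. cl (g n x)) \<in> L2" for n
    by (rule L2_continuous[OF continuous_on_subset[OF cg]]) simp
  have aeN: "AE x in leb. x \<notin> N"
  proof -
    have "AE x in lebesgue. x \<notin> N"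
      using N by (auto simp: negligible_iff_null_sets intro!: AE_not_in)
    then show ?thesis by (subst AE_restrict_space_iff) (auto elim: eventually_mono)
  qed
  have "(\<lambda>n. LINT x|leb. (cmod (f x - cl (g n x)))\<^sup>2) \<longlonglongrightarrow> (LINT x|leb. 0)"
  proof (rule integral_dominated_convergence)
    show "integrable leb (\<lambda>x. (2 * B)\<^sup>2)"
      by (rule integrable_bounded_leb[where B = "(2 * B)\<^sup>2"]) auto
    show "(\<lambda>x. (cmod (f x - cl (g n x)))\<^sup>2) \<in> borel_measurable leb" for n
      using L2_integrable_sq[OF L2_diff[OF f gL2]] by (rule borel_measurable_integrable)
    show "AE x in leb. norm ((cmod (f x - cl (g n x)))\<^sup>2) \<le> (2 * B)\<^sup>2" for n
    proof (rule AE_I2)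
      fix x
      have "cmod (f x - cl (g n x)) \<le> 2 * B"
        using norm_triangle_ineq4[of "f x" "cl (g n x)"] B(2)[of x] cl_le[of "g n x"] by linarith
      then have "(cmod (f x - cl (g n x)))\<^sup>2 \<le> (2 * B)\<^sup>2" by (intro power_mono) auto
      then show "norm ((cmod (f x - cl (g n x)))\<^sup>2) \<le> (2 * B)\<^sup>2" by simp
    qed
    show "AE x in leb. (\<lambda>n. (cmod (f x - cl (g n x)))\<^sup>2) \<longlonglongrightarrow> 0"
      using aeN AE_space
    proof eventually_elim
      case (elim x)
      then have "(\<lambda>n. g n x) \<longlonglongrightarrow> f x" using lim[of x] by auto
      moreover have "isCont cl (f x)" using cont by (simp add: continuous_on_eq_continuous_at)
      ultimately have "(\<lambda>n. cl (g n x)) \<longlonglongrightarrow> cl (f x)" by (rule isCont_tendsto_compose[rotated])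
      then have "(\<lambda>n. (cmod (f x - cl (g n x)))\<^sup>2) \<longlonglongrightarrow> (cmod (f x - f x))\<^sup>2"
        unfolding cl_f by (intro tendsto_intros)
      then show ?case by simp
    qed
  qed simp
  then have "(\<lambda>n. sqnorm (\<lambda>x. f x - cl (g n x))) \<longlonglongrightarrow> 0" by (simp add: sqnorm_def)
  then have "\<forall>\<^sub>F n in sequentially. sqnorm (\<lambda>x. f x - cl (g n x)) < e"
    using e by (rule order_tendstoD)
  then show ?thesis using cg by (auto simp: eventually_sequentially)
qed

lemma trig_dense_L2:
  assumes T: "T > 1" and f: "f \<in> L2" and e: "e > 0"
  shows "\<exists>n. \<exists>p\<in>trig_space T (2 * n + 1). sqnorm (\<lambda>x. f x - p x) < e"
proof -
  obtain g B where g: "g \<in> L2" "B > 0" "\<And>x. cmod (g x) \<le> B" and fg: "sqnorm (\<lambda>x. f x - g x) < e / 4"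
    using L2_approx_bounded[OF f, of "e / 4"] e by auto
  obtain h where h: "continuous_on UNIV h" and gh: "sqnorm (\<lambda>x. g x - h x) < e / 16"
    using L2_approx_continuous_of_bounded[OF g, of "e / 16"] e by auto
  have hL2: "h \<in> L2" by (rule L2_continuous[OF continuous_on_subset[OF h]]) simp
  define d where "d = sqrt (e / 32)"
  have d: "d > 0" "d\<^sup>2 = e / 32" using e by (auto simp: d_def)
  obtain n p where p: "p \<in> trig_space T (2 * n + 1)" and hp: "\<forall>x\<in>{-1..1}. cmod (h x - p x) < d"
    using trig_approx_continuous[OF T continuous_on_subset[OF h] d(1)] by auto
  have pL2: "p \<in> L2" by (rule trig_space_L2[OF p])
  have "sqnorm (\<lambda>x. h x - p x) \<le> (LINT x|leb. d\<^sup>2)"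
    unfolding sqnorm_def
  proof (rule Bochner_Integration.integral_mono)
    show "integrable leb (\<lambda>x. d\<^sup>2)"
      by (rule integrable_bounded_leb[where B = "d\<^sup>2"]) auto
    show "(cmod (h x - p x))\<^sup>2 \<le> d\<^sup>2" if "x \<in> space leb" for x
      using hp that by (intro power_mono) (auto intro: less_imp_le)
  qed (intro L2_integrable_sq L2_diff hL2 pL2)
  also have "\<dots> = e / 16" using d by (simp add: measure_leb)
  finally have hp': "sqnorm (\<lambda>x. h x - p x) \<le> e / 16" .
  have "sqnorm (\<lambda>x. f x - p x) = sqnorm (\<lambda>x. (f x - g x) + ((g x - h x) + (h x - p x)))" by simp
  also have "\<dots> \<le> 2 * sqnorm (\<lambda>x. f x - g x) + 2 * sqnorm (\<lambda>x. (g x - h x) + (h x - p x))"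
    by (intro sqnorm_add_le L2_add L2_diff f g hL2 pL2)
  finally have "sqnorm (\<lambda>x. f x - p x) \<le> 2 * sqnorm (\<lambda>x. f x - g x) + 2 * sqnorm (\<lambda>x. (g x - h x) + (h x - p x))" .
  moreover have "sqnorm (\<lambda>x. (g x - h x) + (h x - p x)) \<le> 2 * sqnorm (\<lambda>x. g x - h x) + 2 * sqnorm (\<lambda>x. h x - p x)"
    by (intro sqnorm_add_le L2_diff g hL2 pL2)
  ultimately have "sqnorm (\<lambda>x. f x - p x) < e" using fg gh hp' by linarith
  then show ?thesis using p by blast
qed


section \<open>Finite linear combinations and three-term recurrences\<close>

text \<open>The real functions that agree on \<open>[-1,1]\<close> with a linear combination of \<open>G 0, \<dots>, G m\<close>. Only
  \<open>[-1,1]\<close> counts because the change of variables below is meaningful only there.\<close>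

definition lincomb :: "(nat \<Rightarrow> real \<Rightarrow> real) \<Rightarrow> nat \<Rightarrow> (real \<Rightarrow> real) set" where
  "lincomb G m = {F. \<exists>a. \<forall>x\<in>{-1..1}. F x = (\<Sum>j\<le>m. a j * G j x)}"

lemma lincomb_base: "j \<le> m \<Longrightarrow> G j \<in> lincomb G m"
  unfolding lincomb_def
  by (intro CollectI exI[of _ "\<lambda>i. if i = j then 1 else 0"])
     (auto simp: if_distrib[of "\<lambda>z. z * _"] sum.delta cong: if_cong)

lemma lincomb_cong:
  "F \<in> lincomb G m \<Longrightarrow> (\<And>x. x \<in> {-1..1} \<Longrightarrow> F' x = F x) \<Longrightarrow> F' \<in> lincomb G m"
  unfolding lincomb_def by auto

lemma lincomb_add:
  assumes "F \<in> lincomb G m" "F' \<in> lincomb G m"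
  shows "(\<lambda>x. F x + F' x) \<in> lincomb G m"
proof -
  obtain a b where "\<forall>x\<in>{-1..1}. F x = (\<Sum>j\<le>m. a j * G j x)" "\<forall>x\<in>{-1..1}. F' x = (\<Sum>j\<le>m. b j * G j x)"
    using assms unfolding lincomb_def by blast
  then have "\<forall>x\<in>{-1..1}. F x + F' x = (\<Sum>j\<le>m. (a j + b j) * G j x)"
    by (simp add: distrib_right sum.distrib)
  then show ?thesis unfolding lincomb_def by (intro CollectI exI)
qed

lemma lincomb_scale:
  assumes "F \<in> lincomb G m"
  shows "(\<lambda>x. c * F x) \<in> lincomb G m"
proof -
  obtain a where "\<forall>x\<in>{-1..1}. F x = (\<Sum>j\<le>m. a j * G j x)"
    using assms unfolding lincomb_def by blast
  then have "\<forall>x\<in>{-1..1}. c * F x = (\<Sum>j\<le>m. (c * a j) * G j x)"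
    by (simp add: sum_distrib_left mult.assoc)
  then show ?thesis unfolding lincomb_def by (intro CollectI exI)
qed

lemma lincomb_diff:
  "F \<in> lincomb G m \<Longrightarrow> F' \<in> lincomb G m \<Longrightarrow> (\<lambda>x. F x - F' x) \<in> lincomb G m"
  using lincomb_add[of F G m "\<lambda>x. (-1) * F' x"] lincomb_scale[of F' G m "-1"] by simp

lemma lincomb_sum:
  assumes "\<And>k. k \<in> K \<Longrightarrow> F k \<in> lincomb G m"
  shows "(\<lambda>x. \<Sum>k\<in>K. F k x) \<in> lincomb G m"
proof -
  have "(\<lambda>x. 0) \<in> lincomb G m"
    using lincomb_scale[OF lincomb_base[of 0 m G], of 0] by simp
  then show ?thesis
    using assms by (induction K rule: infinite_finite_induct) (auto intro!: lincomb_add)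
qed

lemma lincomb_mono:
  assumes "F \<in> lincomb G m" "m \<le> n"
  shows "F \<in> lincomb G n"
proof -
  obtain a where a: "\<forall>x\<in>{-1..1}. F x = (\<Sum>j\<le>m. a j * G j x)"
    using assms unfolding lincomb_def by blast
  have "(\<lambda>x. \<Sum>j\<le>m. a j * G j x) \<in> lincomb G n"
    by (intro lincomb_sum lincomb_scale lincomb_base) (use assms in auto)
  then show ?thesis by (rule lincomb_cong) (use a in auto)
qed

lemma lincomb_mult:
  assumes "F \<in> lincomb G m" and c: "\<And>j. (\<lambda>x. c x * G j x) \<in> lincomb G (Suc j)"
  shows "(\<lambda>x. c x * F x) \<in> lincomb G (Suc m)"
proof -
  obtain a where a: "\<forall>x\<in>{-1..1}. F x = (\<Sum>j\<le>m. a j * G j x)"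
    using assms unfolding lincomb_def by blast
  have "(\<lambda>x. \<Sum>j\<le>m. a j * (c x * G j x)) \<in> lincomb G (Suc m)"
    by (intro lincomb_sum lincomb_scale lincomb_mono[OF c]) auto
  then show ?thesis
    by (rule lincomb_cong) (use a in \<open>auto simp: sum_distrib_left mult_ac\<close>)
qed

text \<open>Both families of cosines and both families of sines that occur below satisfy the recurrence
  \<open>F (k+2) = 2 c F (k+1) - F k\<close>, and the two multipliers \<open>c\<close> are affine functions of each other.
  The following lemma therefore converts between the two variables in both directions.\<close>

lemma lincomb_recurrence:
  assumes c: "\<And>j. (\<lambda>x. c x * G j x) \<in> lincomb G (Suc j)"
    and F: "\<And>k x. x \<in> {-1..1} \<Longrightarrow> F (Suc (Suc k)) x = 2 * (\<alpha> + \<beta> * c x) * F (Suc k) x - F k x"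
    and F0: "F 0 \<in> lincomb G 0" and F1: "F 1 \<in> lincomb G 1"
  shows "F k \<in> lincomb G k"
proof -
  have "F k \<in> lincomb G k \<and> F (Suc k) \<in> lincomb G (Suc k)"
  proof (induction k)
    case 0
    then show ?case using F0 F1 by simp
  next
    case (Suc k)
    have "(\<lambda>x. (2 * \<alpha> * F (Suc k) x + 2 * \<beta> * (c x * F (Suc k) x)) - F k x) \<in> lincomb G (Suc (Suc k))"
      using Suc by (intro lincomb_diff lincomb_add lincomb_scale lincomb_mult[OF _ c])
                   (auto intro: lincomb_mono)
    then have "F (Suc (Suc k)) \<in> lincomb G (Suc (Suc k))"
      by (rule lincomb_cong) (simp add: F algebra_simps)
    with Suc show ?case by simp
  qed
  then show ?thesis by simp
qed

section \<open>Dirichlet kernels\<close>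

text \<open>The Dirichlet kernels for the even frequencies up to \<open>2m\<close> and for the odd frequencies below
  \<open>2m\<close>.\<close>

definition dir_even :: "nat \<Rightarrow> real \<Rightarrow> real" where
  "dir_even m t = 1 + 2 * (\<Sum>j=1..m. cos (2 * real j * t))"

definition dir_odd :: "nat \<Rightarrow> real \<Rightarrow> real" where
  "dir_odd m t = 2 * (\<Sum>j<m. cos ((2 * real j + 1) * t))"

lemma sin_dir_even: "sin t * dir_even m t = sin ((2 * real m + 1) * t)"
proof (induction m)
  case (Suc m)
  have "sin t * dir_even (Suc m) t = sin t * dir_even m t + 2 * sin t * cos (2 * real (Suc m) * t)"
    by (simp add: dir_even_def algebra_simps)
  also have "2 * sin t * cos (2 * real (Suc m) * t) = sin ((2 * real (Suc m) + 1) * t) - sin ((2 * real m + 1) * t)"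
    using sin_add[of "2 * real (Suc m) * t" t] sin_diff[of "2 * real (Suc m) * t" t]
    by (simp add: algebra_simps)
  finally show ?case using Suc by simp
qed (simp add: dir_even_def)

lemma sin_dir_odd: "sin t * dir_odd m t = sin (2 * real m * t)"
proof (induction m)
  case (Suc m)
  have "sin t * dir_odd (Suc m) t = sin t * dir_odd m t + 2 * sin t * cos ((2 * real m + 1) * t)"
    by (simp add: dir_odd_def algebra_simps)
  also have "2 * sin t * cos ((2 * real m + 1) * t) = sin (2 * real (Suc m) * t) - sin (2 * real m * t)"
    using sin_add[of "(2 * real m + 1) * t" t] sin_diff[of "(2 * real m + 1) * t" t]
    by (simp add: algebra_simps)
  finally show ?case using Suc by simp
qed (simp add: dir_odd_def)

text \<open>Unlike the quotients \<open>sin ((2m+1)t) / sin t\<close> and \<open>sin (2mt) / sin t\<close>, this relation is also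
  valid where \<open>sin t = 0\<close>.\<close>

lemma dir_even_eq: "dir_even m t = cos t * dir_odd m t + cos (2 * real m * t)"
proof (induction m)
  case (Suc m)
  have "dir_even (Suc m) t = dir_even m t + 2 * cos (2 * real (Suc m) * t)"
    by (simp add: dir_even_def algebra_simps)
  moreover have "cos t * dir_odd (Suc m) t = cos t * dir_odd m t + 2 * cos t * cos ((2 * real m + 1) * t)"
    by (simp add: dir_odd_def algebra_simps)
  moreover have "2 * cos t * cos ((2 * real m + 1) * t) = cos (2 * real m * t) + cos (2 * real (Suc m) * t)"
    using cos_add[of "(2 * real m + 1) * t" t] cos_diff[of "(2 * real m + 1) * t" t]
    by (simp add: algebra_simps)
  ultimately show ?case using Suc by simp
qed (simp add: dir_even_def dir_odd_def)

section \<open>The change of variables\<close>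

locale fourier_extension =
  fixes T :: real
  assumes T: "T > 1"
begin

text \<open>The angle \<open>\<theta> = \<pi>/(2T)\<close> and its sine. The angle \<open>\<phi> = \<theta>x\<close> of the point \<open>x\<close> gets no name; it ranges
  over \<open>[-\<theta>,\<theta>]\<close>.\<close>

definition theta :: real where "theta = pi / (2 * T)"

definition sigma :: real where "sigma = sin theta"

text \<open>The new variable \<open>\<psi>\<close>, the cosines of \<open>\<phi>\<close> and \<open>\<psi>\<close> as functions of \<open>x\<close>, and the derivative of \<open>\<psi>\<close>.
  The derivative is infinite at \<open>\<plusminus>1\<close>, where \<open>dpsi\<close> has the default value \<open>0\<close> of the quotient.\<close>

definition psi :: "real \<Rightarrow> real" where "psi x = arcsin (sin (theta * x) / sigma)"

definition cos_phi :: "real \<Rightarrow> real" where "cos_phi x = cos (theta * x)"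

definition cos_psi :: "real \<Rightarrow> real" where "cos_psi x = cos (psi x)"

definition dpsi :: "real \<Rightarrow> real" where "dpsi x = theta * cos_phi x / (sigma * cos_psi x)"

lemma theta_bounds: "0 < theta" "theta < pi / 2"
  using T by (auto simp: theta_def field_simps)

lemma sigma_bounds: "0 < sigma" "sigma < 1"
proof -
  show "0 < sigma" unfolding sigma_def using theta_bounds by (intro sin_gt_zero) auto
  have "sin theta < sin (pi / 2)" using theta_bounds by (intro sin_monotone_2pi) auto
  then show "sigma < 1" by (simp add: sigma_def)
qed

lemma cos_theta_pos: "0 < cos theta"
  using theta_bounds by (intro cos_gt_zero) auto

lemma theta_mult_bounds:
  assumes "x \<in> {-1..1}" shows "\<bar>theta * x\<bar> \<le> theta"
  using assms theta_bounds mult_left_mono[of "\<bar>x\<bar>" 1 theta] by (auto simp: abs_mult)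

lemma cos_phi_ge: assumes "x \<in> {-1..1}" shows "cos theta \<le> cos_phi x"
proof -
  have "cos theta \<le> cos \<bar>theta * x\<bar>"
    using theta_bounds theta_mult_bounds[OF assms] by (intro cos_monotone_0_pi_le) auto
  then show ?thesis by (simp add: cos_phi_def)
qed

lemma cos_phi_pos: "x \<in> {-1..1} \<Longrightarrow> 0 < cos_phi x"
  using cos_phi_ge cos_theta_pos by (meson less_le_trans)

lemma cos_phi_le_1: "cos_phi x \<le> 1" and cos_psi_le_1: "cos_psi x \<le> 1"
  by (simp_all add: cos_phi_def cos_psi_def)

lemma sin_theta_mult_bounds:
  assumes "x \<in> {-1..1}" shows "-1 \<le> sin (theta * x) / sigma" "sin (theta * x) / sigma \<le> 1"
proof -
  have "- theta \<le> theta * x" "theta * x \<le> theta" using theta_mult_bounds[OF assms] by linarith+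
  then have "sin (theta * x) \<le> sin theta" "sin (- theta) \<le> sin (theta * x)"
    using theta_bounds by (intro sin_monotone_2pi_le; linarith)+
  then show "-1 \<le> sin (theta * x) / sigma" "sin (theta * x) / sigma \<le> 1"
    using sigma_bounds by (simp_all add: sigma_def field_simps)
qed

lemma sin_theta_mult_bounds_strict:
  assumes "x \<in> {-1<..<1}" shows "-1 < sin (theta * x) / sigma" "sin (theta * x) / sigma < 1"
proof -
  have "theta * x < theta * 1" "theta * (-1) < theta * x" using theta_bounds assms by (intro mult_strict_left_mono; simp)+
  then have "sin (theta * x) < sin theta" "sin (- theta) < sin (theta * x)"
    using theta_bounds by (intro sin_monotone_2pi; linarith)+
  then show "-1 < sin (theta * x) / sigma" "sin (theta * x) / sigma < 1"
    using sigma_bounds by (simp_all add: sigma_def field_simps)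
qed

lemma sin_psi: assumes "x \<in> {-1..1}" shows "sin (psi x) = sin (theta * x) / sigma"
  using sin_theta_mult_bounds[OF assms] by (simp add: psi_def)

lemma psi_bounds: assumes "x \<in> {-1..1}" shows "- (pi / 2) \<le> psi x" "psi x \<le> pi / 2"
  using arcsin_bounded[OF sin_theta_mult_bounds[OF assms]] by (auto simp: psi_def)

lemma psi_bounds_strict: assumes "x \<in> {-1<..<1}" shows "- (pi / 2) < psi x" "psi x < pi / 2"
  using arcsin_lt_bounded[OF sin_theta_mult_bounds_strict[OF assms]] by (auto simp: psi_def)

lemma psi_endpoints: "psi 1 = pi / 2" "psi (-1) = - (pi / 2)"
  using sigma_bounds by (simp_all add: psi_def flip: sigma_def)

lemma psi_minus: assumes "x \<in> {-1..1}" shows "psi (- x) = - psi x"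
  using arcsin_minus[OF sin_theta_mult_bounds[OF assms]] by (simp add: psi_def)

lemma cos_psi_nonneg: "x \<in> {-1..1} \<Longrightarrow> 0 \<le> cos_psi x"
  using psi_bounds[of x] unfolding cos_psi_def by (intro cos_ge_zero) auto

lemma cos_psi_pos: "x \<in> {-1<..<1} \<Longrightarrow> 0 < cos_psi x"
  using psi_bounds_strict[of x] unfolding cos_psi_def by (intro cos_gt_zero_pi) auto

lemma psi_inj: assumes "x \<in> {-1..1}" "y \<in> {-1..1}" "psi x = psi y" shows "x = y"
proof -
  have "sin (theta * x) = sin (theta * y)"
    using sin_psi[OF assms(1)] sin_psi[OF assms(2)] assms(3) sigma_bounds by simp
  moreover have "\<bar>theta * x\<bar> \<le> pi / 2" "\<bar>theta * y\<bar> \<le> pi / 2"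
    using theta_mult_bounds[OF assms(1)] theta_mult_bounds[OF assms(2)] theta_bounds by linarith+
  ultimately have "theta * x = theta * y"
    by (metis sin_inj_pi abs_le_iff minus_le_iff)
  then show ?thesis using theta_bounds by simp
qed

lemma continuous_on_psi: "continuous_on {-1..1} psi"
  unfolding psi_def
  by (intro continuous_intros ballI)
     (use sigma_bounds sin_theta_mult_bounds in auto)

lemma continuous_on_cos_psi: "continuous_on {-1..1} cos_psi"
  unfolding cos_psi_def by (intro continuous_intros continuous_on_psi)

lemma continuous_on_cos_phi: "continuous_on S cos_phi"
  unfolding cos_phi_def by (intro continuous_intros)

lemma psi_deriv:
  assumes "x \<in> {-1<..<1}"
  shows "(psi has_real_derivative dpsi x) (at x)"
proof -
  have b: "-1 < sin (theta * x) / sigma" "sin (theta * x) / sigma < 1"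
    using sin_theta_mult_bounds_strict[OF assms] by auto
  have cos_psi: "cos_psi x = sqrt (1 - (sin (theta * x) / sigma)\<^sup>2)"
    unfolding cos_psi_def psi_def using b by (intro cos_arcsin) auto
  have "((\<lambda>x. arcsin (sin (theta * x) / sigma)) has_real_derivative
      inverse (sqrt (1 - (sin (theta * x) / sigma)\<^sup>2)) * (cos (theta * x) * theta / sigma)) (at x)"
    by (rule DERIV_chain2[where f = arcsin and g = "\<lambda>x. sin (theta * x) / sigma", OF DERIV_arcsin[OF b]])
       (use sigma_bounds in \<open>auto intro!: derivative_eq_intros\<close>)
  then show ?thesis unfolding psi_def[symmetric]
    by (rule DERIV_cong) (use sigma_bounds in \<open>simp add: dpsi_def cos_phi_def cos_psi field_simps\<close>)
qed

text \<open>The relation between the two variables on which all conversions rest.\<close>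

lemma cos2_psi: assumes "x \<in> {-1..1}"
  shows "cos (2 * (theta * x)) = (1 - sigma\<^sup>2) + sigma\<^sup>2 * cos (2 * psi x)"
    "cos (2 * psi x) = (1 - 1 / sigma\<^sup>2) + (1 / sigma\<^sup>2) * cos (2 * (theta * x))"
proof -
  have s: "sin (theta * x) = sigma * sin (psi x)" using sin_psi[OF assms] sigma_bounds by simp
  show 1: "cos (2 * (theta * x)) = (1 - sigma\<^sup>2) + sigma\<^sup>2 * cos (2 * psi x)"
    unfolding cos_double_sin s by (simp add: algebra_simps power_mult_distrib)
  show "cos (2 * psi x) = (1 - 1 / sigma\<^sup>2) + (1 / sigma\<^sup>2) * cos (2 * (theta * x))"
    unfolding 1 using sigma_bounds by (simp add: field_simps)
qed

end


section \<open>Two orthogonal systems\<close>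

lemma leb_integral_eq:
  fixes f :: "real \<Rightarrow> 'a::euclidean_space"
  assumes "integrable leb f" "(f has_integral I) {-1..1}"
  shows "(LINT x|leb. f x) = I"
proof -
  have "(LINT x|leb. f x) = integral {-1<..<1} f"
    using assms(1) by (rule lebesgue_integral_eq_integral) simp
  also have "\<dots> = I"
    using assms(2) by (subst integral_open_interval_real[symmetric]) (rule integral_unique)
  finally show ?thesis .
qed

lemma leb_integral_odd:
  fixes f :: "real \<Rightarrow> real"
  assumes odd: "\<And>x. x \<in> {-1<..<1} \<Longrightarrow> f (- x) = - f x"
  shows "(LINT x|leb. f x) = 0"
proof (cases "integrable leb f")
  case True
  define g where "g x = (if x \<in> {-1<..<1} then f x else 0)" for x
  have "(LINT x|leb. f x) = integral {-1<..<1} f"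
    using True by (rule lebesgue_integral_eq_integral) simp
  also have "\<dots> = integral {-1<..<1} g"
    by (rule integral_cong) (simp add: g_def)
  also have "\<dots> = integral {-1..1} g" by (simp add: integral_open_interval_real)
  finally have *: "(LINT x|leb. f x) = integral {-1..1} g" .
  have "integral {-1..1} g = integral {-1..1} (\<lambda>x. g (- x))"
    using Henstock_Kurzweil_Integration.integral_reflect_real[where a = "-1" and b = 1 and f = g] by simp
  also have "\<dots> = integral {-1..1} (\<lambda>x. - g x)"
    using odd by (intro integral_cong arg_cong2[where f = integral]) (auto simp: g_def)
  also have "\<dots> = - integral {-1..1} g" by simp
  finally show ?thesis using * by simp
qed (simp add: not_integrable_integral_eq)

context fourier_extension
begin

lemma dpsi_nonneg: "x \<in> {-1..1} \<Longrightarrow> 0 \<le> dpsi x"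
  unfolding dpsi_def using theta_bounds sigma_bounds cos_phi_pos[of x] cos_psi_nonneg[of x] by simp

lemma integrable_dpsi: "integrable leb dpsi"
proof -
  have "(dpsi has_integral (psi 1 - psi (-1))) {-1..1}"
    by (rule fundamental_theorem_of_calculus_interior)
       (auto intro!: continuous_on_psi psi_deriv simp flip: has_real_derivative_iff_has_vector_derivative)
  then have "dpsi absolutely_integrable_on {-1..1}"
    by (intro nonnegative_absolutely_integrable_1 dpsi_nonneg) auto
  then have "set_integrable lebesgue {-1<..<1} dpsi"
    by (rule set_integrable_subset) auto
  then show ?thesis
    by (simp add: set_integrable_def integrable_restrict_space)
qed

lemma measurable_dpsi [measurable]: "dpsi \<in> borel_measurable leb"
  using integrable_dpsi by (rule borel_measurable_integrable)

lemma integrable_dpsi_mult: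
  fixes g :: "real \<Rightarrow> 'a::euclidean_space"
  assumes g: "g \<in> borel_measurable leb" and B: "\<And>x. x \<in> {-1<..<1} \<Longrightarrow> norm (g x) \<le> B"
  shows "integrable leb (\<lambda>x. dpsi x *\<^sub>R g x)"
proof (rule Bochner_Integration.integrable_bound)
  show "integrable leb (\<lambda>x. B * dpsi x)"
    by (intro integrable_mult_right integrable_dpsi)
  show "(\<lambda>x. dpsi x *\<^sub>R g x) \<in> borel_measurable leb" using g by measurable
  show "AE x in leb. norm (dpsi x *\<^sub>R g x) \<le> norm (B * dpsi x)"
  proof (rule AE_I2)
    fix x assume "x \<in> space leb"
    then have x: "x \<in> {-1<..<1}" by simp
    then have "0 \<le> dpsi x" "norm (g x) \<le> B" using dpsi_nonneg[of x] B[of x] by auto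
    then have "norm (dpsi x *\<^sub>R g x) \<le> B * dpsi x"
      using mult_right_mono[of "norm (g x)" B "dpsi x"] by (simp add: mult.commute)
    then show "norm (dpsi x *\<^sub>R g x) \<le> norm (B * dpsi x)" by simp
  qed
qed

lemma measurable_comp_psi:
  fixes g :: "real \<Rightarrow> 'a::euclidean_space"
  assumes "continuous_on UNIV g"
  shows "(\<lambda>x. g (psi x)) \<in> borel_measurable leb"
proof -
  have "continuous_on {-1..1} (\<lambda>x. g (psi x))"
    using continuous_on_compose2[OF assms continuous_on_psi] by auto
  then show ?thesis
    by (intro borel_measurable_leb_continuous) (auto intro: continuous_on_subset)
qed

text \<open>Integrals against \<open>dpsi\<close> are integrals over \<open>[-\<pi>/2,\<pi>/2]\<close> in the variable \<open>\<psi>\<close>; the antiderivative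
  \<open>sin (2l\<psi>) / (2l)\<close> vanishes at both end points.\<close>

lemma integral_dpsi_cos:
  "(LINT x|leb. dpsi x * cos (2 * of_int l * psi x)) = (if l = 0 then pi else 0)"
proof -
  have int: "integrable leb (\<lambda>x. dpsi x * cos (2 * of_int l * psi x))"
    using integrable_dpsi_mult[of "\<lambda>x. cos (2 * of_int l * psi x)" 1]
    by (simp add: measurable_comp_psi[of "\<lambda>t. cos (2 * of_int l * t)"] continuous_intros)
  show ?thesis
  proof (cases "l = 0")
    case True
    have "((\<lambda>x. dpsi x * cos (2 * of_int l * psi x)) has_integral (psi 1 - psi (-1))) {-1..1}"
      by (rule fundamental_theorem_of_calculus_interior)
         (auto intro!: continuous_on_psi psi_deriv simp: True simp flip: has_real_derivative_iff_has_vector_derivative)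
    from leb_integral_eq[OF int this] show ?thesis using True by (simp add: psi_endpoints)
  next
    case False
    define F where "F x = sin (2 * of_int l * psi x) / (2 * of_int l)" for x
    have "((\<lambda>x. dpsi x * cos (2 * of_int l * psi x)) has_integral (F 1 - F (-1))) {-1..1}"
    proof (rule fundamental_theorem_of_calculus_interior)
      show "continuous_on {-1..1} F"
        unfolding F_def using False by (intro continuous_intros continuous_on_psi) auto
      fix x :: real assume x: "x \<in> {-1<..<1}"
      have "(F has_real_derivative dpsi x * cos (2 * of_int l * psi x)) (at x)"
        unfolding F_def using False by (auto intro!: derivative_eq_intros psi_deriv[OF x])
      then show "(F has_vector_derivative dpsi x * cos (2 * of_int l * psi x)) (at x)"
        by (simp add: has_real_derivative_iff_has_vector_derivative)
    qed simp
    moreover have "sin (of_int l * pi) = 0" by (metis mult.commute sin_npi_int)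
    then have "F 1 = 0" "F (-1) = 0" by (simp_all add: F_def psi_endpoints mult.commute)
    ultimately show ?thesis using leb_integral_eq[OF int] False by simp
  qed
qed

lemma integral_dpsi_sin: "(LINT x|leb. dpsi x * sin (2 * of_int l * psi x)) = 0"
proof (rule leb_integral_odd)
  fix x :: real assume "x \<in> {-1<..<1}"
  then have "psi (- x) = - psi x" by (intro psi_minus) auto
  then show "dpsi (- x) * sin (2 * of_int l * psi (- x)) = - (dpsi x * sin (2 * of_int l * psi x))"
    by (simp add: dpsi_def cos_phi_def cos_psi_def)
qed

text \<open>The two orthogonal systems. Both are used only for one parity of the frequency, which is what
  makes them orthogonal on an interval of length \<open>\<pi>\<close>.\<close>

definition ecos :: "nat \<Rightarrow> real \<Rightarrow> real" where "ecos j x = cos (2 * real j * psi x)"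

definition osin :: "nat \<Rightarrow> real \<Rightarrow> real" where "osin j x = sin ((2 * real j + 1) * psi x)"

lemma measurable_ecos [measurable]: "ecos j \<in> borel_measurable leb"
  unfolding ecos_def[abs_def] by (rule measurable_comp_psi) (intro continuous_intros)

lemma measurable_osin [measurable]: "osin j \<in> borel_measurable leb"
  unfolding osin_def[abs_def] by (rule measurable_comp_psi) (intro continuous_intros)

lemma ecos_le_1: "\<bar>ecos j x\<bar> \<le> 1" and osin_le_1: "\<bar>osin j x\<bar> \<le> 1"
  by (simp_all add: ecos_def osin_def)

lemma integrable_dpsi_cos: "integrable leb (\<lambda>x. dpsi x * cos (r * psi x))"
  using integrable_dpsi_mult[of "\<lambda>x. cos (r * psi x)" 1]
  by (simp add: measurable_comp_psi[of "\<lambda>t. cos (r * t)"] continuous_intros)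

lemma ecos_orthogonal:
  "integrable leb (\<lambda>x. dpsi x * (ecos i x * ecos j x))"
  "(LINT x|leb. dpsi x * (ecos i x * ecos j x)) = (if i = j then if j = 0 then pi else pi / 2 else 0)"
proof -
  have eq: "dpsi x * (ecos i x * ecos j x) =
    1/2 * (dpsi x * cos (2 * of_int (int i - int j) * psi x)) + 1/2 * (dpsi x * cos (2 * of_int (int i + int j) * psi x))" for x
    unfolding ecos_def by (simp add: cos_times_cos algebra_simps)
  show "integrable leb (\<lambda>x. dpsi x * (ecos i x * ecos j x))"
    unfolding eq by (intro Bochner_Integration.integrable_add integrable_mult_right integrable_dpsi_cos)
  show "(LINT x|leb. dpsi x * (ecos i x * ecos j x)) = (if i = j then if j = 0 then pi else pi / 2 else 0)"
    unfolding eq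
    by (subst Bochner_Integration.integral_add)
       (auto intro!: integrable_mult_right integrable_dpsi_cos
         simp: integral_dpsi_cos integral_mult_right_zero simp del: of_int_diff of_int_add)
qed

lemma osin_orthogonal:
  "integrable leb (\<lambda>x. dpsi x * (osin i x * osin j x))"
  "(LINT x|leb. dpsi x * (osin i x * osin j x)) = (if i = j then pi / 2 else 0)"
proof -
  have eq: "dpsi x * (osin i x * osin j x) =
    1/2 * (dpsi x * cos (2 * of_int (int i - int j) * psi x)) - 1/2 * (dpsi x * cos (2 * of_int (int i + int j + 1) * psi x))" for x
    unfolding osin_def by (simp add: sin_times_sin field_simps)
  show "integrable leb (\<lambda>x. dpsi x * (osin i x * osin j x))"
    unfolding eq by (intro Bochner_Integration.integrable_diff integrable_mult_right integrable_dpsi_cos)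
  have "int i + int j + 1 \<noteq> 0" by simp
  then show "(LINT x|leb. dpsi x * (osin i x * osin j x)) = (if i = j then pi / 2 else 0)"
    unfolding eq
    by (subst Bochner_Integration.integral_diff)
       (auto intro!: integrable_mult_right integrable_dpsi_cos
         simp: integral_dpsi_cos integral_mult_right_zero simp del: of_int_diff of_int_add)
qed

text \<open>The reproducing kernels of the two systems with respect to the measure \<open>dpsi / \<pi>\<close>.\<close>

definition ker_even :: "nat \<Rightarrow> real \<Rightarrow> real \<Rightarrow> real" where
  "ker_even m y x = (\<Sum>i\<le>m. (if i = 0 then 1 else 2) * ecos i y * ecos i x)"

definition ker_odd :: "nat \<Rightarrow> real \<Rightarrow> real \<Rightarrow> real" where
  "ker_odd m y x = (\<Sum>i<m. 2 * osin i y * osin i x)"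

lemma ker_even_reproduces_ecos:
  assumes "j \<le> m"
  shows "integrable leb (\<lambda>x. dpsi x * (ecos j x * ker_even m y x))"
    "(LINT x|leb. dpsi x * (ecos j x * ker_even m y x)) = pi * ecos j y"
proof -
  have eq: "dpsi x * (ecos j x * ker_even m y x) =
    (\<Sum>i\<le>m. ((if i = 0 then 1 else 2) * ecos i y) * (dpsi x * (ecos i x * ecos j x)))" for x
    unfolding ker_even_def sum_distrib_left by (intro sum.cong) (auto simp: mult_ac)
  show "integrable leb (\<lambda>x. dpsi x * (ecos j x * ker_even m y x))"
    unfolding eq by (intro Bochner_Integration.integrable_sum integrable_mult_right ecos_orthogonal)
  have "(LINT x|leb. dpsi x * (ecos j x * ker_even m y x)) =
    (\<Sum>i\<le>m. ((if i = 0 then 1 else 2) * ecos i y) * (if i = j then if j = 0 then pi else pi / 2 else 0))"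
    unfolding eq
    by (subst Bochner_Integration.integral_sum)
       (auto intro!: integrable_mult_right ecos_orthogonal simp only: integral_mult_right_zero ecos_orthogonal(2))
  also have "\<dots> = (\<Sum>i\<le>m. if i = j then pi * ecos j y else 0)"
    by (intro sum.cong) auto
  also have "\<dots> = pi * ecos j y" using assms by simp
  finally show "(LINT x|leb. dpsi x * (ecos j x * ker_even m y x)) = pi * ecos j y" .
qed

lemma ker_odd_reproduces_osin:
  assumes "j < m"
  shows "integrable leb (\<lambda>x. dpsi x * (osin j x * ker_odd m y x))"
    "(LINT x|leb. dpsi x * (osin j x * ker_odd m y x)) = pi * osin j y"
proof -
  have eq: "dpsi x * (osin j x * ker_odd m y x) =
    (\<Sum>i<m. (2 * osin i y) * (dpsi x * (osin i x * osin j x)))" for x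
    unfolding ker_odd_def sum_distrib_left by (intro sum.cong) (auto simp: mult_ac)
  show "integrable leb (\<lambda>x. dpsi x * (osin j x * ker_odd m y x))"
    unfolding eq by (intro Bochner_Integration.integrable_sum integrable_mult_right osin_orthogonal)
  have "(LINT x|leb. dpsi x * (osin j x * ker_odd m y x)) =
    (\<Sum>i<m. (2 * osin i y) * (if i = j then pi / 2 else 0))"
    unfolding eq
    by (subst Bochner_Integration.integral_sum)
       (auto intro!: integrable_mult_right osin_orthogonal simp only: integral_mult_right_zero osin_orthogonal(2))
  also have "\<dots> = (\<Sum>i<m. if i = j then pi * osin j y else 0)"
    by (intro sum.cong) auto
  also have "\<dots> = pi * osin j y" using assms by simp
  finally show "(LINT x|leb. dpsi x * (osin j x * ker_odd m y x)) = pi * osin j y" .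
qed

lemma reproduces_lincomb:
  assumes K: "\<And>j. j \<le> m \<Longrightarrow> integrable leb (\<lambda>x. dpsi x * (G j x * K x))"
      "\<And>j. j \<le> m \<Longrightarrow> (LINT x|leb. dpsi x * (G j x * K x)) = pi * G j y"
    and F: "F \<in> lincomb G m" and y: "y \<in> {-1..1}"
  shows "integrable leb (\<lambda>x. dpsi x * (F x * K x))"
    "(LINT x|leb. dpsi x * (F x * K x)) = pi * F y"
proof -
  obtain a where a: "\<And>x. x \<in> {-1..1} \<Longrightarrow> F x = (\<Sum>j\<le>m. a j * G j x)"
    using F unfolding lincomb_def by blast
  have eq: "dpsi x * (F x * K x) = (\<Sum>j\<le>m. a j * (dpsi x * (G j x * K x)))" if "x \<in> space leb" for x
    using that a[of x] by (simp add: sum_distrib_left sum_distrib_right mult_ac)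
  have "integrable leb (\<lambda>x. \<Sum>j\<le>m. a j * (dpsi x * (G j x * K x)))"
    by (intro Bochner_Integration.integrable_sum integrable_mult_right K) auto
  then show "integrable leb (\<lambda>x. dpsi x * (F x * K x))"
    by (subst Bochner_Integration.integrable_cong[OF refl eq]) auto
  have "(LINT x|leb. dpsi x * (F x * K x)) = (LINT x|leb. (\<Sum>j\<le>m. a j * (dpsi x * (G j x * K x))))"
    by (rule Bochner_Integration.integral_cong[OF refl eq])
  also have "\<dots> = (\<Sum>j\<le>m. a j * (pi * G j y))"
    by (subst Bochner_Integration.integral_sum)
       (auto intro!: integrable_mult_right K simp only: integral_mult_right_zero K(2) atMost_iff intro!: sum.cong)
  also have "\<dots> = pi * F y"
    using a[OF y] by (simp add: sum_distrib_left mult_ac)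
  finally show "(LINT x|leb. dpsi x * (F x * K x)) = pi * F y" .
qed

section \<open>The trigonometric polynomials in the new variable\<close>

text \<open>The cosines and sines that span \<open>\<H>\<^sub>N\<close>. The sine with index \<open>k\<close> has frequency \<open>k + 1\<close>, so
  that it corresponds to \<open>osin 0, \<dots>, osin k\<close>.\<close>

definition cosT :: "nat \<Rightarrow> real \<Rightarrow> real" where "cosT k x = cos (2 * real k * (theta * x))"

definition sinT :: "nat \<Rightarrow> real \<Rightarrow> real" where "sinT k x = sin (2 * real (Suc k) * (theta * x))"

lemma cos_2_mult_cos: "cos (2 * t) * cos (2 * real (Suc j) * t) =
    1/2 * cos (2 * real (Suc (Suc j)) * t) + 1/2 * cos (2 * real j * (t::real))"
  using cos_add[of "2 * real (Suc j) * t" "2 * t"] cos_diff[of "2 * real (Suc j) * t" "2 * t"]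
  by (simp add: algebra_simps)

lemma cos_2_mult_sin: "cos (2 * t) * sin (2 * real (Suc j) * t) =
    1/2 * sin (2 * real (Suc (Suc j)) * t) + 1/2 * sin (2 * real j * (t::real))"
  using sin_add[of "2 * real (Suc j) * t" "2 * t"] sin_diff[of "2 * real (Suc j) * t" "2 * t"]
  by (simp add: algebra_simps)

lemma cos_2_mult_sin_odd: "cos (2 * t) * sin ((2 * real (Suc j) + 1) * t) =
    1/2 * sin ((2 * real (Suc (Suc j)) + 1) * t) + 1/2 * sin ((2 * real j + 1) * (t::real))"
  using sin_add[of "(2 * real (Suc j) + 1) * t" "2 * t"] sin_diff[of "(2 * real (Suc j) + 1) * t" "2 * t"]
  by (simp add: algebra_simps)

lemma sin_3: "sin (3 * t) = 2 * cos (2 * t) * sin t + sin (t :: real)"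
  using sin_add[of "2 * t" t] sin_diff[of "2 * t" t] by (simp add: algebra_simps)

lemma lincomb_two_terms:
  "i \<le> m \<Longrightarrow> j \<le> m \<Longrightarrow> (\<lambda>x. a * G i x + b * G j x) \<in> lincomb G m"
  by (intro lincomb_add lincomb_scale lincomb_base)

lemma cos_mult_ecos: "(\<lambda>x. cos (2 * psi x) * ecos j x) \<in> lincomb ecos (Suc j)"
proof (cases j)
  case 0
  show ?thesis
    by (rule lincomb_cong[OF lincomb_base[of 1]]) (simp_all add: 0 ecos_def)
next
  case (Suc i)
  have "cos (2 * psi x) * ecos (Suc i) x = 1/2 * ecos (Suc (Suc i)) x + 1/2 * ecos i x" for x
    unfolding ecos_def by (rule cos_2_mult_cos)
  then show ?thesis unfolding Suc
    by (intro lincomb_cong[OF lincomb_two_terms[of "Suc (Suc i)" _ i "1/2" ecos "1/2"]]) auto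
qed

lemma cos_mult_osin: "(\<lambda>x. cos (2 * psi x) * osin j x) \<in> lincomb osin (Suc j)"
proof (cases j)
  case 0
  show ?thesis
    by (rule lincomb_cong[OF lincomb_two_terms[of 1 _ 0 "1/2" osin "-1/2"]])
       (simp_all only: 0 osin_def, simp_all add: sin_3 add_divide_distrib)
next
  case (Suc i)
  have "cos (2 * psi x) * osin (Suc i) x = 1/2 * osin (Suc (Suc i)) x + 1/2 * osin i x" for x
    unfolding osin_def by (rule cos_2_mult_sin_odd)
  then show ?thesis unfolding Suc
    by (intro lincomb_cong[OF lincomb_two_terms[of "Suc (Suc i)" _ i "1/2" osin "1/2"]]) auto
qed

lemma cos_mult_cosT: "(\<lambda>x. cos (2 * (theta * x)) * cosT j x) \<in> lincomb cosT (Suc j)"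
proof (cases j)
  case 0
  show ?thesis
    by (rule lincomb_cong[OF lincomb_base[of 1]]) (simp_all add: 0 cosT_def)
next
  case (Suc i)
  have "cos (2 * (theta * x)) * cosT (Suc i) x = 1/2 * cosT (Suc (Suc i)) x + 1/2 * cosT i x" for x
    unfolding cosT_def by (rule cos_2_mult_cos)
  then show ?thesis unfolding Suc
    by (intro lincomb_cong[OF lincomb_two_terms[of "Suc (Suc i)" _ i "1/2" cosT "1/2"]]) auto
qed

lemma cos_mult_sinT: "(\<lambda>x. cos (2 * (theta * x)) * sinT j x) \<in> lincomb sinT (Suc j)"
proof (cases j)
  case 0
  show ?thesis
    by (rule lincomb_cong[OF lincomb_scale[OF lincomb_base[of 1], where c = "1/2"]])
       (simp_all only: 0 sinT_def cos_2_mult_sin, simp_all)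
next
  case (Suc i)
  have "cos (2 * (theta * x)) * sinT (Suc i) x = 1/2 * sinT (Suc (Suc i)) x + 1/2 * sinT i x" for x
    unfolding sinT_def by (rule cos_2_mult_sin)
  then show ?thesis unfolding Suc
    by (intro lincomb_cong[OF lincomb_two_terms[of "Suc (Suc i)" _ i "1/2" sinT "1/2"]]) auto
qed

lemma cosT_lincomb_ecos: "cosT k \<in> lincomb ecos k"
proof (rule lincomb_recurrence[where c = "\<lambda>x. cos (2 * psi x)" and \<alpha> = "1 - sigma\<^sup>2" and \<beta> = "sigma\<^sup>2"])
  show "cosT (Suc (Suc k)) x = 2 * (1 - sigma\<^sup>2 + sigma\<^sup>2 * cos (2 * psi x)) * cosT (Suc k) x - cosT k x"
    if "x \<in> {-1..1}" for k x
    using cos_2_mult_cos[of "theta * x" k] unfolding cos2_psi(1)[OF that, symmetric] cosT_def by simp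
  show "cosT 0 \<in> lincomb ecos 0"
    by (rule lincomb_cong[OF lincomb_base[of 0]]) (simp_all add: cosT_def ecos_def)
  show "cosT 1 \<in> lincomb ecos 1"
    by (rule lincomb_cong[OF lincomb_two_terms[of 0 _ 1 "1 - sigma\<^sup>2" ecos "sigma\<^sup>2"]])
       (use cos2_psi(1) in \<open>simp_all add: cosT_def ecos_def\<close>)
qed (rule cos_mult_ecos)

lemma ecos_lincomb_cosT: "ecos k \<in> lincomb cosT k"
proof (rule lincomb_recurrence[where c = "\<lambda>x. cos (2 * (theta * x))" and \<alpha> = "1 - 1 / sigma\<^sup>2" and \<beta> = "1 / sigma\<^sup>2"])
  show "ecos (Suc (Suc k)) x = 2 * (1 - 1 / sigma\<^sup>2 + 1 / sigma\<^sup>2 * cos (2 * (theta * x))) * ecos (Suc k) x - ecos k x"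
    if "x \<in> {-1..1}" for k x
    using cos_2_mult_cos[of "psi x" k] unfolding cos2_psi(2)[OF that, symmetric] ecos_def by simp
  show "ecos 0 \<in> lincomb cosT 0"
    by (rule lincomb_cong[OF lincomb_base[of 0]]) (simp_all add: cosT_def ecos_def)
  show "ecos 1 \<in> lincomb cosT 1"
    by (rule lincomb_cong[OF lincomb_two_terms[of 0 _ 1 "1 - 1 / sigma\<^sup>2" cosT "1 / sigma\<^sup>2"]])
       (use cos2_psi(2) in \<open>simp_all add: cosT_def ecos_def\<close>)
qed (rule cos_mult_cosT)

lemma sinT_lincomb_osin: "(\<lambda>x. sinT k x / cos_phi x) \<in> lincomb osin k"
proof (rule lincomb_recurrence[where F = "\<lambda>k x. sinT k x / cos_phi x" and
    c = "\<lambda>x. cos (2 * psi x)" and \<alpha> = "1 - sigma\<^sup>2" and \<beta> = "sigma\<^sup>2"])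
  show "sinT (Suc (Suc k)) x / cos_phi x =
      2 * (1 - sigma\<^sup>2 + sigma\<^sup>2 * cos (2 * psi x)) * (sinT (Suc k) x / cos_phi x) - sinT k x / cos_phi x"
    if "x \<in> {-1..1}" for k x
    using cos_2_mult_sin[of "theta * x" "Suc k"] unfolding cos2_psi(1)[OF that, symmetric] sinT_def
    by (simp flip: diff_divide_distrib)
  have 0: "sinT 0 x / cos_phi x = 2 * sigma * osin 0 x" if "x \<in> {-1..1}" for x
    using cos_phi_pos[OF that] sin_psi[OF that] sigma_bounds sin_double[of "theta * x"]
    by (simp add: sinT_def osin_def cos_phi_def)
  show F0: "(\<lambda>x. sinT 0 x / cos_phi x) \<in> lincomb osin 0"
    by (rule lincomb_cong[OF lincomb_scale[OF lincomb_base[of 0], where c = "2 * sigma"]]) (use 0 in auto)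
  have "sinT 1 x / cos_phi x = 2 * (1 - sigma\<^sup>2) * (sinT 0 x / cos_phi x) + 2 * sigma\<^sup>2 * (cos (2 * psi x) * (sinT 0 x / cos_phi x))"
    if "x \<in> {-1..1}" for x
  proof -
    have "sinT 1 x = 2 * cos (2 * (theta * x)) * sinT 0 x"
      using cos_2_mult_sin[of "theta * x" 0] by (simp add: sinT_def)
    then have "sinT 1 x / cos_phi x = 2 * cos (2 * (theta * x)) * (sinT 0 x / cos_phi x)" by simp
    then show ?thesis unfolding cos2_psi(1)[OF that] by (simp only: algebra_simps)
  qed
  moreover have "(\<lambda>x. 2 * (1 - sigma\<^sup>2) * (sinT 0 x / cos_phi x) + 2 * sigma\<^sup>2 * (cos (2 * psi x) * (sinT 0 x / cos_phi x)))
      \<in> lincomb osin (Suc 0)"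
    by (rule lincomb_add[OF lincomb_scale[OF lincomb_mono[OF F0]] lincomb_scale[OF lincomb_mult[OF F0 cos_mult_osin]]]) simp
  ultimately show "(\<lambda>x. sinT 1 x / cos_phi x) \<in> lincomb osin 1"
    unfolding One_nat_def by (rule lincomb_cong[rotated]) auto
qed (rule cos_mult_osin)

lemma osin_lincomb_sinT: "(\<lambda>x. osin k x * cos_phi x) \<in> lincomb sinT k"
proof (rule lincomb_recurrence[where F = "\<lambda>k x. osin k x * cos_phi x" and
    c = "\<lambda>x. cos (2 * (theta * x))" and \<alpha> = "1 - 1 / sigma\<^sup>2" and \<beta> = "1 / sigma\<^sup>2"])
  show "osin (Suc (Suc k)) x * cos_phi x =
      2 * (1 - 1 / sigma\<^sup>2 + 1 / sigma\<^sup>2 * cos (2 * (theta * x))) * (osin (Suc k) x * cos_phi x) - osin k x * cos_phi x"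
    if "x \<in> {-1..1}" for k x
  proof -
    have "osin (Suc (Suc k)) x = 2 * cos (2 * psi x) * osin (Suc k) x - osin k x"
      using cos_2_mult_sin_odd[of "psi x" k] unfolding osin_def by simp
    then show ?thesis unfolding cos2_psi(2)[OF that, symmetric] by (simp only: left_diff_distrib mult.assoc)
  qed
  have 0: "osin 0 x * cos_phi x = 1 / (2 * sigma) * sinT 0 x" if "x \<in> {-1..1}" for x
    using sin_psi[OF that] sigma_bounds sin_double[of "theta * x"]
    by (simp add: sinT_def osin_def cos_phi_def)
  show F0: "(\<lambda>x. osin 0 x * cos_phi x) \<in> lincomb sinT 0"
    by (rule lincomb_cong[OF lincomb_scale[OF lincomb_base[of 0], where c = "1 / (2 * sigma)"]]) (use 0 in auto)
  have "osin 1 x * cos_phi x = (2 * (1 - 1 / sigma\<^sup>2) + 1) * (osin 0 x * cos_phi x)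
      + 2 / sigma\<^sup>2 * (cos (2 * (theta * x)) * (osin 0 x * cos_phi x))"
    if "x \<in> {-1..1}" for x
  proof -
    have "osin 1 x = 2 * cos (2 * psi x) * osin 0 x + osin 0 x"
      using sin_3[of "psi x"] by (simp add: osin_def)
    then have "osin 1 x * cos_phi x = 2 * cos (2 * psi x) * (osin 0 x * cos_phi x) + osin 0 x * cos_phi x"
      by (simp only: distrib_right mult.assoc)
    moreover have "2 * (1 - 1 / sigma\<^sup>2 + 1 / sigma\<^sup>2 * c) * z + z = (2 * (1 - 1 / sigma\<^sup>2) + 1) * z + 2 / sigma\<^sup>2 * (c * z)" for c z
      by (simp add: algebra_simps)
    ultimately show ?thesis unfolding cos2_psi(2)[OF that] by simp
  qed
  moreover have "(\<lambda>x. (2 * (1 - 1 / sigma\<^sup>2) + 1) * (osin 0 x * cos_phi x)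
      + 2 / sigma\<^sup>2 * (cos (2 * (theta * x)) * (osin 0 x * cos_phi x))) \<in> lincomb sinT (Suc 0)"
    by (rule lincomb_add[OF lincomb_scale[OF lincomb_mono[OF F0]] lincomb_scale[OF lincomb_mult[OF F0 cos_mult_sinT]]]) simp
  ultimately show "(\<lambda>x. osin 1 x * cos_phi x) \<in> lincomb sinT 1"
    unfolding One_nat_def by (rule lincomb_cong[rotated]) auto
qed (rule cos_mult_sinT)

lemma cos_psi_squared: "(cos_psi x)\<^sup>2 = 1/2 + 1/2 * cos (2 * psi x)"
  unfolding cos_psi_def cos_double_cos by (simp add: diff_divide_distrib)

lemma cos_psi_squared_mult_lincomb:
  assumes F: "F \<in> lincomb G m" and "\<And>j. (\<lambda>x. cos (2 * psi x) * G j x) \<in> lincomb G (Suc j)"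
  shows "(\<lambda>x. (cos_psi x)\<^sup>2 * F x) \<in> lincomb G (Suc m)"
proof -
  have "(\<lambda>x. 1/2 * F x + 1/2 * (cos (2 * psi x) * F x)) \<in> lincomb G (Suc m)"
    by (rule lincomb_add[OF lincomb_scale[OF lincomb_mono[OF F]] lincomb_scale[OF lincomb_mult[OF assms]]]) simp
  then show ?thesis by (rule lincomb_cong) (simp add: cos_psi_squared distrib_right)
qed

end


section \<open>A kernel that reproduces trigonometric polynomials\<close>

context fourier_extension
begin

text \<open>The two parts of the kernel reproduce, up to the factor \<open>lam y\<close>, the even and the odd
  trigonometric polynomials and annihilate those of the other parity. The weights come from
  \<open>cos\<^sup>2 \<psi> dpsi = (\<theta>/\<sigma>) cos \<phi> cos \<psi>\<close>. The factor \<open>cos\<^sup>2 \<psi>\<close> removes the singularity of \<open>dpsi\<close> at the end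
  points at the price of one more frequency in each part.\<close>

definition Ker :: "nat \<Rightarrow> real \<Rightarrow> real \<Rightarrow> real" where
  "Ker m y x = cos_psi x * cos_phi x * ker_even m y x + cos_psi x * cos_phi y * ker_odd m y x"

lemma continuous_on_ecos: "continuous_on {-1..1} (ecos j)"
  unfolding ecos_def[abs_def] by (intro continuous_intros continuous_on_psi)

lemma continuous_on_osin: "continuous_on {-1..1} (osin j)"
  unfolding osin_def[abs_def] by (intro continuous_intros continuous_on_psi)

lemma continuous_on_ker_even: "continuous_on {-1..1} (ker_even m y)"
  unfolding ker_even_def[abs_def] by (intro continuous_intros continuous_on_ecos)

lemma continuous_on_ker_odd: "continuous_on {-1..1} (ker_odd m y)"
  unfolding ker_odd_def[abs_def] by (intro continuous_intros continuous_on_osin)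

lemma continuous_on_Ker: "continuous_on {-1..1} (Ker m y)"
  unfolding Ker_def[abs_def]
  by (intro continuous_intros continuous_on_cos_psi continuous_on_cos_phi continuous_on_ker_even continuous_on_ker_odd)

lemma integrable_continuous_leb:
  fixes f :: "real \<Rightarrow> real"
  assumes "continuous_on {-1..1} f" shows "integrable leb f"
proof -
  have "(\<lambda>x. complex_of_real (f x)) \<in> L2"
    by (intro L2_continuous continuous_intros assms)
  from integrable_Re[OF L2_integrable[OF this]] show ?thesis by simp
qed

lemma cos_psi_minus: "x \<in> {-1..1} \<Longrightarrow> cos_psi (- x) = cos_psi x"
  by (simp add: cos_psi_def psi_minus)

lemma cos_phi_minus: "cos_phi (- x) = cos_phi x"
  by (simp add: cos_phi_def)

lemma ker_even_minus: "x \<in> {-1..1} \<Longrightarrow> ker_even m y (- x) = ker_even m y x"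
  by (simp add: ker_even_def ecos_def psi_minus)

lemma ker_odd_minus: "x \<in> {-1..1} \<Longrightarrow> ker_odd m y (- x) = - ker_odd m y x"
  by (simp add: ker_odd_def osin_def psi_minus flip: sum_negf)

lemma continuous_on_cosT: "continuous_on S (cosT k)"
  unfolding cosT_def[abs_def] by (intro continuous_intros)

lemma continuous_on_sinT: "continuous_on S (sinT k)"
  unfolding sinT_def[abs_def] by (intro continuous_intros)

text \<open>The factor with which the kernel reproduces.\<close>

definition lam :: "real \<Rightarrow> real" where "lam y = pi * sigma / theta * (cos_psi y)\<^sup>2"

lemma lam_pos: "y \<in> {-1<..<1} \<Longrightarrow> 0 < lam y"
  using cos_psi_pos[of y] sigma_bounds theta_bounds by (simp add: lam_def)

lemma Ker_reproduces_cosT: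
  assumes k: "k < m" and y: "y \<in> {-1..1}"
  shows "(LINT x|leb. cosT k x * Ker m y x) = lam y * cosT k y"
proof -
  have F: "(\<lambda>x. (cos_psi x)\<^sup>2 * cosT k x) \<in> lincomb ecos m"
    by (rule lincomb_mono[OF cos_psi_squared_mult_lincomb[OF cosT_lincomb_ecos cos_mult_ecos]]) (use k in simp)
  note rep = reproduces_lincomb(2)[OF ker_even_reproduces_ecos F y]
  have c1: "continuous_on {-1..1} (\<lambda>x. cosT k x * (cos_psi x * cos_phi x * ker_even m y x))"
    by (intro continuous_intros continuous_on_cos_psi continuous_on_cos_phi continuous_on_ker_even continuous_on_cosT)
  have c2: "continuous_on {-1..1} (\<lambda>x. cosT k x * (cos_psi x * cos_phi y * ker_odd m y x))"
    by (intro continuous_intros continuous_on_cos_psi continuous_on_ker_odd continuous_on_cosT)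
  have "(LINT x|leb. cosT k x * Ker m y x) =
      (LINT x|leb. cosT k x * (cos_psi x * cos_phi x * ker_even m y x)) + (LINT x|leb. cosT k x * (cos_psi x * cos_phi y * ker_odd m y x))"
    unfolding Ker_def distrib_left
    by (intro Bochner_Integration.integral_add integrable_continuous_leb c1 c2)
  also have "(LINT x|leb. cosT k x * (cos_psi x * cos_phi y * ker_odd m y x)) = 0"
    by (rule leb_integral_odd) (simp add: cos_psi_minus ker_odd_minus cosT_def)
  also have "(LINT x|leb. cosT k x * (cos_psi x * cos_phi x * ker_even m y x)) =
      (LINT x|leb. sigma / theta * (dpsi x * ((cos_psi x)\<^sup>2 * cosT k x * ker_even m y x)))"
  proof (rule Bochner_Integration.integral_cong[OF refl])
    fix x assume "x \<in> space leb"
    then have "cos_psi x \<noteq> 0" using cos_psi_pos[of x] by auto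
    then show "cosT k x * (cos_psi x * cos_phi x * ker_even m y x) =
        sigma / theta * (dpsi x * ((cos_psi x)\<^sup>2 * cosT k x * ker_even m y x))"
      using theta_bounds sigma_bounds by (simp add: dpsi_def power2_eq_square)
  qed
  also have "\<dots> = sigma / theta * (pi * ((cos_psi y)\<^sup>2 * cosT k y))"
    by (simp only: integral_mult_right_zero rep)
  finally show ?thesis by (simp add: lam_def)
qed

lemma Ker_reproduces_sinT:
  assumes k: "Suc k < m" and y: "y \<in> {-1..1}"
  shows "(LINT x|leb. sinT k x * Ker m y x) = lam y * sinT k y"
proof -
  have F: "(\<lambda>x. (cos_psi x)\<^sup>2 * (sinT k x / cos_phi x)) \<in> lincomb osin (m - 1)"
    by (rule lincomb_mono[OF cos_psi_squared_mult_lincomb[OF sinT_lincomb_osin cos_mult_osin]]) (use k in simp)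
  have m: "j < m" if "j \<le> m - 1" for j using that k by linarith
  note rep = reproduces_lincomb(2)[OF ker_odd_reproduces_osin(1)[OF m] ker_odd_reproduces_osin(2)[OF m] F y]
  have c1: "continuous_on {-1..1} (\<lambda>x. sinT k x * (cos_psi x * cos_phi x * ker_even m y x))"
    by (intro continuous_intros continuous_on_cos_psi continuous_on_cos_phi continuous_on_ker_even continuous_on_sinT)
  have c2: "continuous_on {-1..1} (\<lambda>x. sinT k x * (cos_psi x * cos_phi y * ker_odd m y x))"
    by (intro continuous_intros continuous_on_cos_psi continuous_on_ker_odd continuous_on_sinT)
  have "(LINT x|leb. sinT k x * Ker m y x) =
      (LINT x|leb. sinT k x * (cos_psi x * cos_phi x * ker_even m y x)) + (LINT x|leb. sinT k x * (cos_psi x * cos_phi y * ker_odd m y x))"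
    unfolding Ker_def distrib_left
    by (intro Bochner_Integration.integral_add integrable_continuous_leb c1 c2)
  also have "(LINT x|leb. sinT k x * (cos_psi x * cos_phi x * ker_even m y x)) = 0"
    by (rule leb_integral_odd) (simp add: cos_psi_minus cos_phi_minus ker_even_minus sinT_def)
  also have "(LINT x|leb. sinT k x * (cos_psi x * cos_phi y * ker_odd m y x)) =
      (LINT x|leb. (cos_phi y * sigma / theta) * (dpsi x * ((cos_psi x)\<^sup>2 * (sinT k x / cos_phi x) * ker_odd m y x)))"
  proof (rule Bochner_Integration.integral_cong[OF refl])
    fix x assume "x \<in> space leb"
    then have "cos_psi x \<noteq> 0" "cos_phi x \<noteq> 0" using cos_psi_pos[of x] cos_phi_pos[of x] by auto
    then show "sinT k x * (cos_psi x * cos_phi y * ker_odd m y x) =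
        (cos_phi y * sigma / theta) * (dpsi x * ((cos_psi x)\<^sup>2 * (sinT k x / cos_phi x) * ker_odd m y x))"
      using theta_bounds sigma_bounds by (simp add: dpsi_def power2_eq_square)
  qed
  also have "\<dots> = (cos_phi y * sigma / theta) * (pi * ((cos_psi y)\<^sup>2 * (sinT k y / cos_phi y)))"
    by (simp only: integral_mult_right_zero rep)
  finally show ?thesis using cos_phi_pos[OF y] by (simp add: lam_def)
qed

lemma two_theta: "pi / T * x = 2 * (theta * x)"
  using T by (simp add: theta_def)

lemma Ker_L2: "(\<lambda>x. complex_of_real (Ker m y x)) \<in> L2"
  by (intro L2_continuous continuous_intros continuous_on_Ker)

lemma wave_L2: "wave T k \<in> L2"
  by (intro L2_continuous continuous_on_wave)

lemma Ker_reproduces_wave: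
  assumes k: "\<bar>k\<bar> < int m" and y: "y \<in> {-1..1}"
  shows "(LINT x|leb. wave T k x * of_real (Ker m y x)) = of_real (lam y) * wave T k y"
proof -
  define j where "j = nat \<bar>k\<bar>"
  have j: "j < m" "real j = \<bar>real_of_int k\<bar>" using k by (auto simp: j_def)
  \<comment> \<open>The factor \<open>sgn k\<close> accounts for negative frequencies and is \<open>0\<close> for \<open>k = 0\<close>.\<close>
  have w: "wave T k x = of_real (cosT j x) + \<i> * of_real (sgn (real_of_int k) * sin (2 * real j * (theta * x)))" for x
  proof -
    have "pi / T * of_int k * x = 2 * of_int k * (theta * x)"
      using two_theta[of "of_int k * x"] by (simp add: mult_ac)
    then show ?thesis unfolding wave_cis cosT_def j(2)
      by (cases "k \<ge> 0") (auto simp: complex_eq_iff sgn_if)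
  qed
  have s: "(LINT x|leb. sin (2 * real j * (theta * x)) * Ker m y x) = lam y * sin (2 * real j * (theta * y))"
  proof (cases j)
    case (Suc i)
    then show ?thesis using Ker_reproduces_sinT[of i m y] j(1) y by (simp only: sinT_def)
  qed simp
  have i1: "integrable leb (\<lambda>x. complex_of_real (cosT j x * Ker m y x))"
    and i2: "integrable leb (\<lambda>x. complex_of_real (sin (2 * real j * (theta * x)) * Ker m y x))"
    by (intro integrable_of_real integrable_continuous_leb continuous_intros continuous_on_cosT continuous_on_Ker)+
  have "(LINT x|leb. wave T k x * of_real (Ker m y x)) =
    (LINT x|leb. of_real (cosT j x * Ker m y x) +
      \<i> * of_real (sgn (real_of_int k)) * of_real (sin (2 * real j * (theta * x)) * Ker m y x))"
    unfolding w by (simp add: algebra_simps)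
  also have "\<dots> = (LINT x|leb. complex_of_real (cosT j x * Ker m y x)) +
      \<i> * of_real (sgn (real_of_int k)) * (LINT x|leb. complex_of_real (sin (2 * real j * (theta * x)) * Ker m y x))"
    using i1 i2 by (subst Bochner_Integration.integral_add)
      (auto intro!: integrable_mult_right simp only: integral_mult_right_zero)
  also have "\<dots> = of_real (lam y) * wave T k y"
    unfolding integral_complex_of_real s Ker_reproduces_cosT[OF j(1) y] w by (simp add: algebra_simps)
  finally show ?thesis .
qed

lemma Ker_reproduces:
  assumes p: "p \<in> trig_space T (2 * n + 1)" and y: "y \<in> {-1..1}"
  shows "(LINT x|leb. p x * of_real (Ker (Suc n) y x)) = of_real (lam y) * p y"
proof -
  obtain c where c: "p = (\<lambda>x. \<Sum>k = - int n..int n. c k * wave T k x)"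
    using p unfolding trig_space_odd by blast
  have "(LINT x|leb. p x * of_real (Ker (Suc n) y x)) =
      (LINT x|leb. (\<Sum>k = - int n..int n. c k * (wave T k x * of_real (Ker (Suc n) y x))))"
    unfolding c sum_distrib_right by (simp only: mult.assoc)
  also have "\<dots> = (\<Sum>k = - int n..int n. c k * (LINT x|leb. wave T k x * of_real (Ker (Suc n) y x)))"
    by (subst Bochner_Integration.integral_sum)
       (auto intro!: integrable_mult_right L2_mult_integrable Ker_L2 wave_L2 simp only: integral_mult_right_zero)
  also have "\<dots> = (\<Sum>k = - int n..int n. c k * (of_real (lam y) * wave T k y))"
    by (intro sum.cong refl) (subst Ker_reproduces_wave, use y in auto)
  also have "\<dots> = of_real (lam y) * p y"
    unfolding c sum_distrib_left by (simp only: mult_ac)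
  finally show ?thesis .
qed

section \<open>Existence, uniqueness and convergence of the projection\<close>

text \<open>An element of \<open>\<H>\<^sub>N\<close> times the exponential with frequency \<open>n\<close> is an algebraic polynomial in the
  exponential with frequency \<open>1\<close>.\<close>

lemma trig_space_vanishing:
  assumes p: "p \<in> trig_space T (2 * n + 1)" and 0: "\<And>x. x \<in> {-1<..<1} \<Longrightarrow> p x = 0"
  shows "p = (\<lambda>x. 0)"
proof -
  obtain c where c: "p = (\<lambda>x. \<Sum>k = - int n..int n. c k * wave T k x)"
    using p unfolding trig_space_odd by blast
  define d where "d i = c (int i - int n)" for i
  have wave_pow: "wave T 1 x ^ i = wave T (int i) x" for x i
    unfolding wave_cis Complex.DeMoivre by (simp add: mult_ac)
  have poly: "wave T (int n) x * p x = (\<Sum>i\<le>2 * n. d i * wave T 1 x ^ i)" for x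
  proof -
    have "wave T (int n) x * p x = (\<Sum>k = - int n..int n. c k * wave T (int n + k) x)"
      unfolding c sum_distrib_left by (simp add: mult_ac flip: wave_mult)
    also have "\<dots> = (\<Sum>i\<le>2 * n. d i * wave T 1 x ^ i)"
      unfolding wave_pow d_def
      by (rule sum.reindex_bij_witness[of _ "\<lambda>i. int i - int n" "\<lambda>k. nat (k + int n)"]) (auto simp: add.commute)
    finally show ?thesis .
  qed
  have inj: "inj_on (wave T 1) {-1<..<1}"
  proof (rule inj_onI)
    fix x y assume xy: "x \<in> {-1<..<1}" "y \<in> {-1<..<1}" and eq: "wave T 1 x = wave T 1 y"
    have "cos (pi / T * x) = cos (pi / T * y)" "sin (pi / T * x) = sin (pi / T * y)"
      using arg_cong[OF eq, of Re] arg_cong[OF eq, of Im] by (simp_all add: wave_cis)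
    then show "x = y" using xy by (intro sin_cos_separate[OF T, of x y]) simp_all
  qed
  have "wave T 1 ` {-1<..<1} \<subseteq> {z. (\<Sum>i\<le>2 * n. d i * z ^ i) = 0}"
    using poly[symmetric] 0 by auto
  moreover have "infinite (wave T 1 ` {-1<..<1})"
    using finite_imageD[OF _ inj] infinite_Ioo[of "-1::real" 1] by auto
  ultimately have "infinite {z. (\<Sum>i\<le>2 * n. d i * z ^ i) = 0}"
    using finite_subset by blast
  then have d0: "d i = 0" if "i \<le> 2 * n" for i
    using that polyfun_finite_roots[of d "2 * n"] by blast
  have "c k = 0" if "k \<in> {- int n..int n}" for k
    using d0[of "nat (k + int n)"] that by (auto simp: d_def)
  then show ?thesis unfolding c by (intro ext sum.neutral) auto
qed

lemma orth_proj_exists: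
  assumes f: "f \<in> L2"
  shows "\<exists>p. p \<in> trig_space T (2 * n + 1) \<and> (\<forall>q\<in>trig_space T (2 * n + 1). L2_inner (\<lambda>x. f x - p x) q = 0)"
proof -
  obtain c where c: "\<forall>j\<in>{- int n..int n}.
      L2_inner (\<lambda>x. f x - (\<Sum>k = - int n..int n. c k * wave T k x)) (wave T j) = 0"
    using projection_exists[of "{- int n..int n}" "wave T", OF finite_atLeastAtMost_int wave_L2 f] ..
  define p where "p = (\<lambda>x. \<Sum>k = - int n..int n. c k * wave T k x)"
  have perp: "L2_inner (\<lambda>x. f x - p x) (wave T j) = 0" if "j \<in> {- int n..int n}" for j
    using c that by (simp add: p_def)
  have p: "p \<in> trig_space T (2 * n + 1)" unfolding trig_space_odd p_def by blast
  have fp: "(\<lambda>x. f x - p x) \<in> L2" by (rule L2_diff[OF f trig_space_L2[OF p]])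
  have "L2_inner (\<lambda>x. f x - p x) q = 0" if q: "q \<in> trig_space T (2 * n + 1)" for q
  proof -
    obtain d where "q = (\<lambda>x. \<Sum>k = - int n..int n. d k * wave T k x)"
      using q unfolding trig_space_odd by blast
    then show ?thesis using perp fp by (simp add: L2_inner_sum_right wave_L2)
  qed
  then show ?thesis using p by blast
qed

text \<open>The reproducing property turns vanishing almost everywhere into vanishing on \<open>(-1,1)\<close>.\<close>

lemma orth_proj_unique:
  assumes f: "f \<in> L2"
    and p: "p \<in> trig_space T (2 * n + 1)" "\<forall>q\<in>trig_space T (2 * n + 1). L2_inner (\<lambda>x. f x - p x) q = 0"
    and r: "r \<in> trig_space T (2 * n + 1)" "\<forall>q\<in>trig_space T (2 * n + 1). L2_inner (\<lambda>x. f x - r x) q = 0"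
  shows "p = r"
proof -
  define d where "d = (\<lambda>x. p x - r x)"
  have d: "d \<in> trig_space T (2 * n + 1)" unfolding d_def by (rule trig_space_diff[OF p(1) r(1)])
  note L2 = f trig_space_L2[OF p(1)] trig_space_L2[OF r(1)] trig_space_L2[OF d]
  have "d = (\<lambda>x. (f x - r x) - (f x - p x))" by (simp add: d_def)
  then have "L2_inner d d = L2_inner (\<lambda>x. (f x - r x) - (f x - p x)) d" by simp
  also have "\<dots> = 0"
    using p(2) r(2) d by (subst L2_inner_diff_left) (auto intro!: L2_diff L2)
  finally have "sqnorm d = 0" by (simp add: L2_inner_self)
  then have ae: "AE x in leb. d x = 0" by (rule sqnorm_zero_AE[OF L2(4)])
  have "d y = 0" if y: "y \<in> {-1<..<1}" for y
  proof -
    have "of_real (lam y) * d y = (LINT x|leb. d x * of_real (Ker (Suc n) y x))"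
      using Ker_reproduces[OF d, of y] y by auto
    also have "\<dots> = 0" by (rule integral_eq_zero_AE) (use ae in \<open>auto elim: eventually_mono\<close>)
    finally show ?thesis using lam_pos[OF y] by simp
  qed
  from trig_space_vanishing[OF d this] show ?thesis by (auto simp: d_def fun_eq_iff)
qed

lemma orth_proj_props:
  assumes f: "f \<in> L2"
  shows "orth_proj T (2 * n + 1) f \<in> trig_space T (2 * n + 1)"
    "\<And>q. q \<in> trig_space T (2 * n + 1) \<Longrightarrow> L2_inner (\<lambda>x. f x - orth_proj T (2 * n + 1) f x) q = 0"
proof -
  have "\<exists>!p. p \<in> trig_space T (2 * n + 1) \<and>
      (\<forall>q\<in>trig_space T (2 * n + 1). L2_inner (\<lambda>x. f x - p x) q = 0)"
    using orth_proj_exists[OF f] orth_proj_unique[OF f] by (intro ex_ex1I) blast+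
  from theI'[OF this, folded orth_proj_def]
  show "orth_proj T (2 * n + 1) f \<in> trig_space T (2 * n + 1)"
    "\<And>q. q \<in> trig_space T (2 * n + 1) \<Longrightarrow> L2_inner (\<lambda>x. f x - orth_proj T (2 * n + 1) f x) q = 0"
    by auto
qed

lemma orth_proj_converges:
  assumes f: "f \<in> L2"
  shows "(\<lambda>n. sqnorm (\<lambda>x. f x - orth_proj T (2 * n + 1) f x)) \<longlonglongrightarrow> 0"
proof (rule order_tendstoI)
  fix e :: real assume "e < 0"
  then show "\<forall>\<^sub>F n in sequentially. e < sqnorm (\<lambda>x. f x - orth_proj T (2 * n + 1) f x)"
    using sqnorm_nonneg less_le_trans by (intro always_eventually allI) blast
next
  fix e :: real assume e: "e > 0"
  obtain m q where q: "q \<in> trig_space T (2 * m + 1)" and fq: "sqnorm (\<lambda>x. f x - q x) < e"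
    using trig_dense_L2[OF T f e] by blast
  have "sqnorm (\<lambda>x. f x - orth_proj T (2 * n + 1) f x) < e" if "n \<ge> m" for n
  proof -
    define p where "p = orth_proj T (2 * n + 1) f"
    note pp = orth_proj_props[OF f, where n = n, folded p_def]
    have pq: "(\<lambda>x. p x - q x) \<in> trig_space T (2 * n + 1)"
      by (rule trig_space_diff[OF pp(1) trig_space_mono[OF q that]])
    have "sqnorm (\<lambda>x. (f x - p x) + (p x - q x)) = sqnorm (\<lambda>x. f x - p x) + sqnorm (\<lambda>x. p x - q x)"
      by (intro sqnorm_add L2_diff f trig_space_L2[OF pp(1)] trig_space_L2[OF pq] pp(2)[OF pq])
    then show ?thesis using fq sqnorm_nonneg[of "\<lambda>x. p x - q x"] by (simp add: p_def)
  qed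
  then show "\<forall>\<^sub>F n in sequentially. sqnorm (\<lambda>x. f x - orth_proj T (2 * n + 1) f x) < e"
    unfolding eventually_sequentially by blast
qed

end


section \<open>Size and expansion of the kernel\<close>

context fourier_extension
begin

lemma ker_even_dirichlet:
  "2 * ker_even m y x = dir_even m (psi x - psi y) + dir_even m (psi x + psi y)"
proof (induction m)
  case 0
  then show ?case by (simp add: ker_even_def dir_even_def ecos_def)
next
  case (Suc m)
  have "2 * ker_even (Suc m) y x = 2 * ker_even m y x + 4 * (ecos (Suc m) y * ecos (Suc m) x)"
    by (simp add: ker_even_def)
  moreover have "2 * (ecos (Suc m) y * ecos (Suc m) x) =
      cos (2 * real (Suc m) * (psi x - psi y)) + cos (2 * real (Suc m) * (psi x + psi y))"
    using cos_add[of "2 * real (Suc m) * psi x" "2 * real (Suc m) * psi y"]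
      cos_diff[of "2 * real (Suc m) * psi x" "2 * real (Suc m) * psi y"]
    unfolding ecos_def distrib_left right_diff_distrib by simp
  moreover have "dir_even (Suc m) t = dir_even m t + 2 * cos (2 * real (Suc m) * t)" for t
    by (simp add: dir_even_def)
  ultimately show ?case using Suc by simp
qed

lemma ker_odd_dirichlet:
  "2 * ker_odd m y x = dir_odd m (psi x - psi y) - dir_odd m (psi x + psi y)"
proof (induction m)
  case 0
  then show ?case by (simp add: ker_odd_def dir_odd_def)
next
  case (Suc m)
  have "2 * ker_odd (Suc m) y x = 2 * ker_odd m y x + 4 * (osin m y * osin m x)"
    by (simp add: ker_odd_def)
  moreover have "2 * (osin m y * osin m x) =
      cos ((2 * real m + 1) * (psi x - psi y)) - cos ((2 * real m + 1) * (psi x + psi y))"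
    using cos_add[of "(2 * real m + 1) * psi x" "(2 * real m + 1) * psi y"]
      cos_diff[of "(2 * real m + 1) * psi x" "(2 * real m + 1) * psi y"]
    unfolding osin_def distrib_left[of "2 * real m + 1"] right_diff_distrib[of "2 * real m + 1"] by simp
  moreover have "dir_odd (Suc m) t = dir_odd m t + 2 * cos ((2 * real m + 1) * t)" for t
    by (simp add: dir_odd_def)
  ultimately show ?case using Suc by simp
qed

text \<open>The common denominator of the Dirichlet kernels that make up \<open>ker_even\<close> and \<open>ker_odd\<close>. It
  vanishes for \<open>x = y\<close> and for \<open>x = -y\<close>, and it divides the differences of the weights
  (\<open>cos_psi_diff\<close>, \<open>cos_phi_diff\<close>).\<close>

definition sinsin :: "real \<Rightarrow> real \<Rightarrow> real" where
  "sinsin y x = sin (psi x - psi y) * sin (psi x + psi y)"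

lemma abs_mult_le_1: "\<bar>a\<bar> \<le> 1 \<Longrightarrow> \<bar>b\<bar> \<le> 1 \<Longrightarrow> \<bar>a * b\<bar> \<le> (1::real)"
  using mult_mono[of "\<bar>a\<bar>" 1 "\<bar>b\<bar>" 1] by (simp add: abs_mult)

lemma sinsin_ker_even: "\<bar>sinsin y x * ker_even m y x\<bar> \<le> 1"
proof -
  define u v where "u = psi x - psi y" and "v = psi x + psi y"
  have "2 * (sinsin y x * ker_even m y x) = sinsin y x * (2 * ker_even m y x)" by simp
  also have "\<dots> = (sin u * dir_even m u) * sin v + (sin v * dir_even m v) * sin u"
    unfolding ker_even_dirichlet sinsin_def u_def[symmetric] v_def[symmetric] by (simp add: algebra_simps)
  also have "\<bar>\<dots>\<bar> \<le> 1 + 1"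
    unfolding sin_dir_even by (intro order_trans[OF abs_triangle_ineq] add_mono abs_mult_le_1) auto
  finally show ?thesis by simp
qed

lemma sinsin_ker_odd: "\<bar>sinsin y x * ker_odd m y x\<bar> \<le> 1"
proof -
  define u v where "u = psi x - psi y" and "v = psi x + psi y"
  have "2 * (sinsin y x * ker_odd m y x) = sinsin y x * (2 * ker_odd m y x)" by simp
  also have "\<dots> = (sin u * dir_odd m u) * sin v - (sin v * dir_odd m v) * sin u"
    unfolding ker_odd_dirichlet sinsin_def u_def[symmetric] v_def[symmetric] by (simp add: algebra_simps)
  also have "\<bar>\<dots>\<bar> \<le> 1 + 1"
    unfolding sin_dir_odd by (intro order_trans[OF abs_triangle_ineq4] add_mono abs_mult_le_1) auto
  finally show ?thesis by simp
qed

lemma sinsin_eq: "sinsin y x = (sin (psi x))\<^sup>2 - (sin (psi y))\<^sup>2"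
proof -
  have "sinsin y x = (sin (psi x))\<^sup>2 * (cos (psi y))\<^sup>2 - (cos (psi x))\<^sup>2 * (sin (psi y))\<^sup>2"
    by (simp add: sinsin_def sin_add sin_diff power2_eq_square algebra_simps)
  also have "\<dots> = (sin (psi x))\<^sup>2 - (sin (psi y))\<^sup>2"
    by (simp add: cos_squared_eq algebra_simps)
  finally show ?thesis .
qed

lemma cos_psi_diff:
  assumes "x \<in> {-1..1}" "y \<in> {-1<..<1}"
  shows "cos_psi x - cos_psi y = - (sinsin y x / (cos_psi x + cos_psi y))"
proof -
  have "cos_psi x + cos_psi y \<noteq> 0" using cos_psi_nonneg[OF assms(1)] cos_psi_pos[OF assms(2)] by linarith
  moreover have "(cos_psi x - cos_psi y) * (cos_psi x + cos_psi y) = - sinsin y x"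
    unfolding sinsin_eq by (simp add: cos_psi_def sin_squared_eq power2_eq_square algebra_simps)
  ultimately show ?thesis by (simp add: field_simps)
qed

lemma cos_phi_diff:
  assumes x: "x \<in> {-1..1}" and y: "y \<in> {-1..1}"
  shows "cos_phi x - cos_phi y = - (sigma\<^sup>2 * sinsin y x / (cos_phi x + cos_phi y))"
proof -
  have "cos_phi x + cos_phi y \<noteq> 0" using cos_phi_pos[OF x] cos_phi_pos[OF y] by linarith
  moreover have "sigma\<^sup>2 * sinsin y x = (sin (theta * x))\<^sup>2 - (sin (theta * y))\<^sup>2"
    unfolding sinsin_eq sin_psi[OF x] sin_psi[OF y] using sigma_bounds by (simp add: power_divide field_simps)
  then have "sigma\<^sup>2 * sinsin y x = (cos_phi y)\<^sup>2 - (cos_phi x)\<^sup>2"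
    by (simp add: cos_phi_def sin_squared_eq)
  then have "(cos_phi x - cos_phi y) * (cos_phi x + cos_phi y) = - (sigma\<^sup>2 * sinsin y x)"
    by (simp add: power2_eq_square algebra_simps)
  ultimately show ?thesis by (simp add: field_simps)
qed

text \<open>An element of \<open>\<H>\<^sub>N\<close> close to \<open>Ker (n+1) y\<close>: the constant weight \<open>cos \<psi>(y) cos \<phi>(y)\<close> makes the
  even part a trigonometric polynomial, and so does the factor \<open>cos \<phi>(x)\<close> for the odd part; the top
  frequency of each part is removed.\<close>

definition trimmed_ker :: "nat \<Rightarrow> real \<Rightarrow> real \<Rightarrow> real" where
  "trimmed_ker n y x = cos_psi y * cos_phi y * ker_even n y x + cos_psi y * cos_phi x * ker_odd n y x"

lemma continuous_on_trimmed_ker: "continuous_on {-1..1} (trimmed_ker n y)"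
  unfolding trimmed_ker_def[abs_def]
  by (intro continuous_intros continuous_on_cos_phi continuous_on_ker_even continuous_on_ker_odd)

lemma lincomb_in_trig_space:
  assumes F: "F \<in> lincomb G m" and G: "\<And>j. j \<le> m \<Longrightarrow> (\<lambda>x. complex_of_real (G j x)) \<in> trig_space T (2 * n + 1)"
  shows "\<exists>q\<in>trig_space T (2 * n + 1). \<forall>x\<in>{-1..1}. q x = of_real (F x)"
proof -
  obtain a where a: "\<forall>x\<in>{-1..1}. F x = (\<Sum>j\<le>m. a j * G j x)"
    using F unfolding lincomb_def by blast
  have "(\<lambda>x. \<Sum>j\<le>m. of_real (a j) * of_real (G j x)) \<in> trig_space T (2 * n + 1)"
    using G by (intro trig_space_sum trig_space_scale) auto
  then show ?thesis using a by (intro bexI) auto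
qed

lemma trimmed_ker_in_trig_space:
  "\<exists>q\<in>trig_space T (2 * n + 1). \<forall>x\<in>{-1..1}. q x = of_real (trimmed_ker n y x)"
proof -
  have cosT: "(\<lambda>x. complex_of_real (cosT j x)) \<in> trig_space T (2 * n + 1)" if "j \<le> n" for j
  proof -
    have "cosT j x = cos (pi / T * real j * x)" for x
      using two_theta[of "real j * x"] by (simp add: cosT_def mult_ac)
    then show ?thesis using cos_in_trig_space[OF that, of T] by simp
  qed
  have sinT: "(\<lambda>x. complex_of_real (sinT j x)) \<in> trig_space T (2 * n + 1)" if "Suc j \<le> n" for j
  proof -
    have "sinT j x = sin (pi / T * real (Suc j) * x)" for x
      using two_theta[of "real (Suc j) * x"] by (simp only: sinT_def mult_ac)
    then show ?thesis using sin_in_trig_space[OF that, of T] by simp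
  qed
  have "(\<lambda>x. cos_psi y * cos_phi y * ker_even n y x) \<in> lincomb cosT n"
    unfolding ker_even_def
    by (intro lincomb_scale lincomb_sum lincomb_mono[OF ecos_lincomb_cosT]) auto
  from lincomb_in_trig_space[OF this cosT]
  obtain p where p: "p \<in> trig_space T (2 * n + 1)" "\<forall>x\<in>{-1..1}. p x = of_real (cos_psi y * cos_phi y * ker_even n y x)"
    by blast
  obtain q where q: "q \<in> trig_space T (2 * n + 1)" "\<forall>x\<in>{-1..1}. q x = of_real (cos_psi y * cos_phi x * ker_odd n y x)"
  proof (cases n)
    case 0
    then show ?thesis using that[OF trig_space_zero] by (simp add: ker_odd_def)
  next
    case (Suc i)
    have "(\<lambda>x. \<Sum>j<n. (cos_psi y * 2 * osin j y) * (osin j x * cos_phi x)) \<in> lincomb sinT i"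
      by (intro lincomb_scale lincomb_sum lincomb_mono[OF osin_lincomb_sinT]) (auto simp: Suc)
    then have "(\<lambda>x. cos_psi y * cos_phi x * ker_odd n y x) \<in> lincomb sinT i"
      by (rule lincomb_cong) (simp add: ker_odd_def sum_distrib_left mult_ac)
    from lincomb_in_trig_space[OF this sinT] show ?thesis using that Suc by auto
  qed
  show ?thesis
    using p q trig_space_add[OF p(1) q(1)] by (intro bexI[of _ "\<lambda>x. p x + q x"]) (auto simp: trimmed_ker_def)
qed

text \<open>The bound does not depend on \<open>n\<close>.\<close>

lemma Ker_minus_trimmed_ker_bounded:
  assumes x: "x \<in> {-1..1}" and y: "y \<in> {-1<..<1}"
  shows "\<bar>Ker (Suc n) y x - trimmed_ker n y x\<bar> \<le> 2 / cos_psi y + 2 / cos theta + 4"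
proof -
  have y': "y \<in> {-1..1}" using y by auto
  define A where "A = cos_phi x / (cos_psi x + cos_psi y)"
  define A' where "A' = cos_phi y / (cos_psi x + cos_psi y)"
  define B where "B = cos_psi y * (sigma\<^sup>2 / (cos_phi x + cos_phi y))"
  note pos = cos_psi_nonneg[OF x] cos_psi_pos[OF y] cos_phi_pos[OF x] cos_phi_pos[OF y'] cos_phi_ge[OF x] cos_theta_pos sigma_bounds
  have A: "\<bar>A\<bar> \<le> 1 / cos_psi y" "\<bar>A'\<bar> \<le> 1 / cos_psi y"
    using pos cos_phi_le_1[of x] cos_phi_le_1[of y] by (auto simp: A_def A'_def intro!: frac_le)
  have sg2: "sigma\<^sup>2 \<le> 1" using sigma_bounds by (simp add: power_le_one)
  have "sigma\<^sup>2 / (cos_phi x + cos_phi y) \<le> 1 / cos theta"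
    using pos sg2 by (intro frac_le) auto
  then have "\<bar>B\<bar> \<le> 1 * (1 / cos theta)"
    using pos cos_psi_le_1[of y] unfolding B_def abs_mult by (intro mult_mono) auto
  then have B: "\<bar>B\<bar> \<le> 1 / cos theta" by simp
  define SE where "SE = sinsin y x * ker_even (Suc n) y x"
  define SO where "SO = sinsin y x * ker_odd (Suc n) y x"
  have S: "\<bar>SE\<bar> \<le> 1" "\<bar>SO\<bar> \<le> 1"
    unfolding SE_def SO_def by (rule sinsin_ker_even sinsin_ker_odd)+
  have d1: "cos_psi x * cos_phi x - cos_psi y * cos_phi y = - sinsin y x * (A + B)"
  proof -
    have "cos_psi x * cos_phi x - cos_psi y * cos_phi y = cos_phi x * (cos_psi x - cos_psi y) + cos_psi y * (cos_phi x - cos_phi y)" by (simp add: algebra_simps)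
    also have "\<dots> = - sinsin y x * (A + B)"
      unfolding cos_psi_diff[OF x y] cos_phi_diff[OF x y'] A_def B_def by (simp add: algebra_simps)
    finally show ?thesis .
  qed
  have d2: "cos_psi x * cos_phi y - cos_psi y * cos_phi x = - sinsin y x * (A' - B)"
  proof -
    have "cos_psi x * cos_phi y - cos_psi y * cos_phi x = cos_phi y * (cos_psi x - cos_psi y) - cos_psi y * (cos_phi x - cos_phi y)" by (simp add: algebra_simps)
    also have "\<dots> = - sinsin y x * (A' - B)"
      unfolding cos_psi_diff[OF x y] cos_phi_diff[OF x y'] A'_def B_def by (simp add: algebra_simps)
    finally show ?thesis .
  qed
  define P where "P = (cos_psi y * cos_phi y) * (ecos (Suc n) y * ecos (Suc n) x)"
  define Q where "Q = (cos_psi y * cos_phi x) * (osin n y * osin n x)"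
  have c1: "\<bar>cos_psi t\<bar> \<le> 1" "\<bar>cos_phi t\<bar> \<le> 1" for t by (simp_all add: cos_psi_def cos_phi_def)
  have PQ: "\<bar>P\<bar> \<le> 1" "\<bar>Q\<bar> \<le> 1"
    unfolding P_def Q_def by (intro abs_mult_le_1 c1 ecos_le_1 osin_le_1)+
  have e: "ker_even n y x = ker_even (Suc n) y x - 2 * (ecos (Suc n) y * ecos (Suc n) x)"
    by (simp add: ker_even_def)
  have o: "ker_odd n y x = ker_odd (Suc n) y x - 2 * (osin n y * osin n x)"
    by (simp add: ker_odd_def)
  have "Ker (Suc n) y x - trimmed_ker n y x =
      (cos_psi x * cos_phi x - cos_psi y * cos_phi y) * ker_even (Suc n) y x + (cos_psi x * cos_phi y - cos_psi y * cos_phi x) * ker_odd (Suc n) y x + 2 * P + 2 * Q"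
    unfolding Ker_def trimmed_ker_def e o P_def Q_def by (simp add: algebra_simps)
  also have "\<dots> = - (SE * (A + B)) - SO * (A' - B) + 2 * P + 2 * Q"
    unfolding d1 d2 SE_def SO_def by (simp add: algebra_simps)
  finally have eq: "Ker (Suc n) y x - trimmed_ker n y x = - (SE * (A + B)) - SO * (A' - B) + 2 * P + 2 * Q" .
  have AB: "\<bar>A + B\<bar> \<le> 1 / cos_psi y + 1 / cos theta" "\<bar>A' - B\<bar> \<le> 1 / cos_psi y + 1 / cos theta"
    using A B by linarith+
  have "\<bar>SE * (A + B)\<bar> \<le> 1 * (1 / cos_psi y + 1 / cos theta)" "\<bar>SO * (A' - B)\<bar> \<le> 1 * (1 / cos_psi y + 1 / cos theta)"
    unfolding abs_mult by (intro mult_mono S AB; simp)+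
  then show ?thesis unfolding eq using PQ by (simp add: abs_le_iff)
qed

text \<open>The two coefficients in the expansion of the kernel. The singularity of the Dirichlet kernels
  at \<open>psi x = - psi y\<close> cancels between the even and the odd part, so that only the one at
  \<open>psi x = psi y\<close>, that is, at \<open>x = y\<close>, is left.\<close>

definition coeff_diff :: "real \<Rightarrow> real \<Rightarrow> real" where
  "coeff_diff y x = (cos_psi x * cos_phi x * cos (psi x - psi y) + cos_psi x * cos_phi y) / sin (psi x - psi y)"

definition coeff_sum :: "real \<Rightarrow> real \<Rightarrow> real" where
  "coeff_sum y x = - cos_psi x * (cos_phi x * sin (psi x + psi y) / (1 + cos (psi x + psi y)) + sigma\<^sup>2 * sin (psi x - psi y) / (cos_phi x + cos_phi y))"

lemma sin_psi_diff_nonzero: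
  assumes x: "x \<in> {-1..1}" and y: "y \<in> {-1<..<1}" and "x \<noteq> y"
  shows "sin (psi x - psi y) \<noteq> 0"
proof
  assume 0: "sin (psi x - psi y) = 0"
  have "\<bar>psi x - psi y\<bar> < pi" using psi_bounds[OF x] psi_bounds_strict[OF y] by linarith
  with 0 have "psi x = psi y" using sin_eq_0_pi[of "psi x - psi y"] by (simp add: abs_less_iff)
  then show False using psi_inj[OF x, of y] y \<open>x \<noteq> y\<close> by auto
qed

lemma cos_psi_add_pos:
  assumes x: "x \<in> {-1..1}" and y: "y \<in> {-1<..<1}"
  shows "0 < 1 + cos (psi x + psi y)"
proof -
  have "- pi < psi x + psi y" "psi x + psi y < pi"
    using psi_bounds[OF x] psi_bounds_strict[OF y] by linarith+
  then have "0 < cos ((psi x + psi y) / 2)" by (intro cos_gt_zero_pi) auto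
  moreover have "1 + cos (2 * t) = 2 * (cos t)\<^sup>2" for t :: real
    by (simp add: cos_double_cos)
  from this[of "(psi x + psi y) / 2"] have "1 + cos (psi x + psi y) = 2 * (cos ((psi x + psi y) / 2))\<^sup>2"
    by (simp only: nonzero_mult_div_cancel_left times_divide_eq_right zero_neq_numeral not_False_eq_True)
  ultimately show ?thesis by simp
qed

lemma Ker_expansion:
  assumes x: "x \<in> {-1..1}" and y: "y \<in> {-1<..<1}" and "x \<noteq> y"
  defines "u \<equiv> psi x - psi y" and "v \<equiv> psi x + psi y" and "w \<equiv> cos_psi x * cos_phi x"
  shows "2 * Ker m y x = w * cos (2 * real m * u) + w * cos (2 * real m * v)
    + sin (2 * real m * u) * coeff_diff y x + sin (2 * real m * v) * coeff_sum y x"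
proof -
  have y': "y \<in> {-1..1}" using y by auto
  have "2 * Ker m y x = w * (2 * ker_even m y x) + cos_psi x * cos_phi y * (2 * ker_odd m y x)"
    by (simp add: Ker_def w_def algebra_simps)
  also have "\<dots> = w * cos (2 * real m * u) + w * cos (2 * real m * v)
      + dir_odd m u * (w * cos u + cos_psi x * cos_phi y) + dir_odd m v * (w * cos v - cos_psi x * cos_phi y)"
    unfolding ker_even_dirichlet ker_odd_dirichlet u_def[symmetric] v_def[symmetric] dir_even_eq
    by (simp add: algebra_simps)
  also have "dir_odd m u * (w * cos u + cos_psi x * cos_phi y) = sin (2 * real m * u) * coeff_diff y x"
    using sin_psi_diff_nonzero[OF x y \<open>x \<noteq> y\<close>] unfolding sin_dir_odd[symmetric]
    by (simp add: coeff_diff_def u_def w_def)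
  also have "w * cos v - cos_psi x * cos_phi y = sin v * coeff_sum y x"
  proof -
    have pos: "1 + cos v \<noteq> 0" using cos_psi_add_pos[OF x y] by (simp add: v_def)
    have "cos v - 1 = - (sin v * (sin v / (1 + cos v)))"
    proof -
      have "(cos v - 1) * (1 + cos v) = - (sin v)\<^sup>2"
        by (simp add: sin_squared_eq power2_eq_square algebra_simps)
      then show ?thesis using pos by (simp add: field_simps power2_eq_square)
    qed
    moreover have "cos_phi x - cos_phi y = - (sin v * (sigma\<^sup>2 * sin u / (cos_phi x + cos_phi y)))"
      unfolding cos_phi_diff[OF x y'] by (simp add: sinsin_def u_def v_def)
    moreover have "w * cos v - cos_psi x * cos_phi y = cos_psi x * (cos_phi x * (cos v - 1) + (cos_phi x - cos_phi y))"
      by (simp add: w_def algebra_simps)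
    ultimately have "w * cos v - cos_psi x * cos_phi y =
        cos_psi x * (cos_phi x * - (sin v * (sin v / (1 + cos v))) + - (sin v * (sigma\<^sup>2 * sin u / (cos_phi x + cos_phi y))))" by simp
    also have "\<dots> = sin v * coeff_sum y x"
      unfolding coeff_sum_def u_def[symmetric] v_def[symmetric] by (simp add: algebra_simps)
    finally show ?thesis .
  qed
  also have "dir_odd m v * (sin v * coeff_sum y x) = sin (2 * real m * v) * coeff_sum y x"
    unfolding sin_dir_odd[symmetric] by simp
  finally show ?thesis .
qed

text \<open>The sines with the even frequencies of \<open>ecos\<close>.\<close>

definition esin :: "nat \<Rightarrow> real \<Rightarrow> real" where "esin m x = sin (2 * real m * psi x)"

lemma Ker_expansion':
  assumes x: "x \<in> {-1..1}" and y: "y \<in> {-1<..<1}" and "x \<noteq> y"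
  shows "Ker m y x = ecos m y * ((cos_psi x * cos_phi x) * ecos m x)
    + esin m y * ((coeff_sum y x - coeff_diff y x) / 2 * ecos m x) + ecos m y * ((coeff_diff y x + coeff_sum y x) / 2 * esin m x)"
proof -
  have *: "cos (2 * real m * (psi x - psi y)) = ecos m x * ecos m y + esin m x * esin m y"
    "cos (2 * real m * (psi x + psi y)) = ecos m x * ecos m y - esin m x * esin m y"
    "sin (2 * real m * (psi x - psi y)) = esin m x * ecos m y - ecos m x * esin m y"
    "sin (2 * real m * (psi x + psi y)) = esin m x * ecos m y + ecos m x * esin m y"
    unfolding distrib_left right_diff_distrib ecos_def esin_def
    by (simp_all add: cos_add cos_diff sin_add sin_diff)
  show ?thesis using Ker_expansion[OF assms, of m] unfolding * by (simp add: field_simps)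
qed

end


section \<open>A uniform Riemann--Lebesgue lemma\<close>

text \<open>If the integrals of every square-integrable function against \<open>e n\<close> tend to \<open>0\<close>, they do so
  uniformly for the products of \<open>f\<close> with a compact family of continuous coefficients. Continuity
  in \<open>x\<close> is required only on a set \<open>S\<close> off which \<open>f\<close> vanishes. Uniform continuity reduces the family to
  a finite one.\<close>

lemma uniform_oscillatory_limit:
  fixes k :: "real \<Rightarrow> real \<Rightarrow> real" and e :: "nat \<Rightarrow> real \<Rightarrow> real"
  assumes f: "f \<in> L2" and K: "compact K" and S: "compact S"
    and k: "continuous_on (K \<times> S) (\<lambda>(y, x). k y x)"
    and f0: "\<And>x. x \<in> {-1<..<1} - S \<Longrightarrow> f x = 0"
    and e: "\<And>n. e n \<in> borel_measurable leb" "\<And>n x. \<bar>e n x\<bar> \<le> 1"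
    and rl: "\<And>g. g \<in> L2 \<Longrightarrow> (\<lambda>n. LINT x|leb. g x * of_real (e n x)) \<longlonglongrightarrow> 0"
  shows "uniform_limit K (\<lambda>n y. LINT x|leb. f x * of_real (k y x * e n x)) (\<lambda>_. 0) sequentially"
proof (rule uniform_limitI)
  fix \<epsilon> :: real assume \<epsilon>: "\<epsilon> > 0"
  have k_y: "continuous_on S (k y)" if "y \<in> K" for y
  proof -
    have "continuous_on S (\<lambda>x. (\<lambda>(y, x). k y x) (y, x))"
      by (rule continuous_on_compose2[OF k continuous_on_Pair[OF continuous_on_const continuous_on_id]])
         (use that in auto)
    then show ?thesis by simp
  qed
  have fk: "(\<lambda>x. of_real (k y x) * f x) \<in> L2" if "y \<in> K" for y
    by (rule L2_mult_continuous_support[OF f S k_y[OF that] f0])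
  define I where "I = (LINT x|leb. cmod (f x))"
  have If: "integrable leb (\<lambda>x. cmod (f x))" using L2_integrable[OF f] by (rule integrable_norm)
  have I0: "0 \<le> I" unfolding I_def by (rule Bochner_Integration.integral_nonneg) auto
  define \<eta> where "\<eta> = \<epsilon> / (2 * (I + 1))"
  have \<eta>: "\<eta> > 0" "\<eta> * I < \<epsilon> / 2"
    using \<epsilon> I0 by (auto simp: \<eta>_def field_simps)
  obtain \<delta> where \<delta>: "\<delta> > 0"
    and uc: "\<And>p q. p \<in> K \<times> S \<Longrightarrow> q \<in> K \<times> S \<Longrightarrow> dist q p < \<delta> \<Longrightarrow>
        dist (case q of (y, x) \<Rightarrow> k y x) (case p of (y, x) \<Rightarrow> k y x) < \<eta>"
    using compact_uniformly_continuous[OF k compact_Times[OF K S]] \<eta>(1)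
    unfolding uniformly_continuous_on_def by metis
  have "K \<subseteq> (\<Union>y\<in>K. ball y \<delta>)" using \<delta> by auto
  from compactE_image[OF K open_ball this]
  obtain Y where Y: "Y \<subseteq> K" "finite Y" "K \<subseteq> (\<Union>y\<in>Y. ball y \<delta>)" .
  have "\<forall>\<^sub>F n in sequentially. cmod (LINT x|leb. (of_real (k y x) * f x) * of_real (e n x)) < \<epsilon> / 2" if "y \<in> Y" for y
  proof -
    have "y \<in> K" using Y(1) that by auto
    from tendstoD[OF rl[OF fk[OF this]], of "\<epsilon> / 2"] \<epsilon> show ?thesis by simp
  qed
  then have "\<forall>\<^sub>F n in sequentially. \<forall>y\<in>Y. cmod (LINT x|leb. (of_real (k y x) * f x) * of_real (e n x)) < \<epsilon> / 2"
    using Y(2) by (simp add: eventually_ball_finite)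
  then show "\<forall>\<^sub>F n in sequentially. \<forall>y\<in>K. dist (LINT x|leb. f x * of_real (k y x * e n x)) 0 < \<epsilon>"
  proof eventually_elim
    case (elim n)
    show ?case
    proof
      fix z assume z: "z \<in> K"
      obtain y where y: "y \<in> Y" "dist y z < \<delta>" using Y(3) z by auto
      have yK: "y \<in> K" using y Y by auto
      have eL2: "(\<lambda>x. complex_of_real (e n x)) \<in> L2"
        by (rule L2_bounded[where B = 1]) (use e in \<open>auto intro: borel_measurable_of_real\<close>)
      have int: "integrable leb (\<lambda>x. (of_real (k w x) * f x) * of_real (e n x))" if "w \<in> K" for w
        by (rule L2_mult_integrable[OF fk[OF that] eL2])
      have close: "\<bar>k z x - k y x\<bar> * cmod (f x) \<le> \<eta> * cmod (f x)" if "x \<in> {-1<..<1}" for x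
      proof (cases "x \<in> S")
        case True
        then have "\<bar>k z x - k y x\<bar> \<le> \<eta>"
          using uc[of "(y, x)" "(z, x)"] z yK y(2)
          by (auto simp: dist_Pair_Pair dist_commute dist_real_def)
        then show ?thesis by (rule mult_right_mono) simp
      qed (use f0 that in auto)
      have "cmod ((LINT x|leb. (of_real (k z x) * f x) * of_real (e n x)) - (LINT x|leb. (of_real (k y x) * f x) * of_real (e n x)))
        = cmod (LINT x|leb. (of_real (k z x) * f x) * of_real (e n x) - (of_real (k y x) * f x) * of_real (e n x))"
        by (simp add: Bochner_Integration.integral_diff int z yK)
      also have "\<dots> \<le> (LINT x|leb. \<eta> * cmod (f x))"
      proof (rule Bochner_Integration.integral_norm_bound_integral)
        show "integrable leb (\<lambda>x. (of_real (k z x) * f x) * of_real (e n x) - (of_real (k y x) * f x) * of_real (e n x))"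
          by (intro Bochner_Integration.integrable_diff int z yK)
        show "integrable leb (\<lambda>x. \<eta> * cmod (f x))" by (intro integrable_mult_right If)
        fix x assume x: "x \<in> space leb"
        have "(of_real (k z x) * f x) * of_real (e n x) - (of_real (k y x) * f x) * of_real (e n x)
          = of_real (k z x - k y x) * f x * of_real (e n x)" by (simp add: algebra_simps)
        then have "cmod ((of_real (k z x) * f x) * of_real (e n x) - (of_real (k y x) * f x) * of_real (e n x))
          = \<bar>k z x - k y x\<bar> * cmod (f x) * \<bar>e n x\<bar>" by (simp only: norm_mult norm_of_real)
        also have "\<dots> \<le> \<eta> * cmod (f x) * 1"
          using x \<eta>(1) by (intro mult_mono close e) auto
        finally show "cmod ((of_real (k z x) * f x) * of_real (e n x) - (of_real (k y x) * f x) * of_real (e n x))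
          \<le> \<eta> * cmod (f x)" by simp
      qed
      also have "\<dots> = \<eta> * I" by (simp add: I_def)
      finally have "cmod ((LINT x|leb. (of_real (k z x) * f x) * of_real (e n x)) - (LINT x|leb. (of_real (k y x) * f x) * of_real (e n x))) < \<epsilon> / 2"
        using \<eta>(2) by linarith
      moreover have "cmod (LINT x|leb. (of_real (k y x) * f x) * of_real (e n x)) < \<epsilon> / 2"
        using elim y by blast
      ultimately have "cmod (LINT x|leb. (of_real (k z x) * f x) * of_real (e n x)) < \<epsilon>"
        using norm_triangle_sub[of "LINT x|leb. (of_real (k z x) * f x) * of_real (e n x)"
            "LINT x|leb. (of_real (k y x) * f x) * of_real (e n x)"] by linarith
      also have "(LINT x|leb. (of_real (k z x) * f x) * of_real (e n x)) = (LINT x|leb. f x * of_real (k z x * e n x))"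
        by (rule Bochner_Integration.integral_cong[OF refl]) (simp add: mult_ac)
      finally show "dist (LINT x|leb. f x * of_real (k z x * e n x)) 0 < \<epsilon>" by simp
    qed
  qed
qed

context fourier_extension
begin

text \<open>The exponentials of even frequency in \<open>\<psi>\<close>, an orthogonal system with respect to \<open>dpsi\<close>.\<close>

definition ecis :: "nat \<Rightarrow> real \<Rightarrow> complex" where "ecis j x = cis (2 * real j * psi x)"

lemma measurable_ecis [measurable]: "ecis j \<in> borel_measurable leb"
  unfolding ecis_def[abs_def]
  by (rule measurable_comp_psi) (intro continuous_intros)

lemma cmod_ecis [simp]: "cmod (ecis j x) = 1"
  by (simp add: ecis_def)

lemma ecis_L2: "ecis j \<in> L2"
  by (rule L2_bounded[where B = 1]) auto

lemma ecis_orthogonal: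
  "integrable leb (\<lambda>x. dpsi x *\<^sub>R (ecis j x * cnj (ecis k x)))"
  "(LINT x|leb. dpsi x *\<^sub>R (ecis j x * cnj (ecis k x))) = (if j = k then of_real pi else 0)"
proof -
  define l where "l = int j - int k"
  have eq: "dpsi x *\<^sub>R (ecis j x * cnj (ecis k x)) =
     of_real (dpsi x * cos (2 * of_int l * psi x)) + \<i> * of_real (dpsi x * sin (2 * of_int l * psi x))" for x
    by (simp add: ecis_def cis_cnj cis_mult l_def complex_eq_iff algebra_simps)
  have s: "integrable leb (\<lambda>x. dpsi x * sin (2 * of_int l * psi x))"
    using integrable_dpsi_mult[of "\<lambda>x. sin (2 * of_int l * psi x)" 1]
    by (simp add: measurable_comp_psi[of "\<lambda>t. sin (2 * of_int l * t)"] continuous_intros)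
  show "integrable leb (\<lambda>x. dpsi x *\<^sub>R (ecis j x * cnj (ecis k x)))"
    unfolding eq by (intro Bochner_Integration.integrable_add integrable_mult_right integrable_of_real s integrable_dpsi_cos)
  have "(LINT x|leb. dpsi x *\<^sub>R (ecis j x * cnj (ecis k x))) =
    (LINT x|leb. complex_of_real (dpsi x * cos (2 * of_int l * psi x))) + (LINT x|leb. \<i> * complex_of_real (dpsi x * sin (2 * of_int l * psi x)))"
    unfolding eq by (intro Bochner_Integration.integral_add integrable_mult_right integrable_of_real s integrable_dpsi_cos)
  also have "\<dots> = (if j = k then of_real pi else 0)"
    unfolding integral_mult_right_zero integral_complex_of_real integral_dpsi_cos integral_dpsi_sin by (simp add: l_def)
  finally show "(LINT x|leb. dpsi x *\<^sub>R (ecis j x * cnj (ecis k x))) = (if j = k then of_real pi else 0)" .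
qed

text \<open>Bessel's inequality for the function \<open>f / dpsi\<close> in the space with weight \<open>dpsi\<close>. The weight on the
  right-hand side is \<open>1 / dpsi\<close>, which is bounded.\<close>

lemma ecis_bessel:
  assumes f: "f \<in> L2"
  defines "a \<equiv> \<lambda>j. L2_inner f (ecis j)"
  shows "(\<Sum>j<N. (cmod (a j))\<^sup>2) \<le> pi * (LINT x|leb. (cmod (f x))\<^sup>2 * (sigma * cos_psi x / (theta * cos_phi x)))"
proof -
  define r where "r x = sigma * cos_psi x / (theta * cos_phi x)" for x
  define s where "s x = (\<Sum>j<N. of_real (1 / pi) * a j * ecis j x)" for x
  have r_cont: "continuous_on {-1..1} r"
    unfolding r_def[abs_def] by (intro continuous_intros continuous_on_cos_psi continuous_on_cos_phi)
      (use theta_bounds cos_phi_pos in \<open>auto simp: less_le\<close>)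
  have sL2: "s \<in> L2" unfolding s_def[abs_def] by (intro L2_sum L2_scale ecis_L2)
  define b where "b = (\<Sum>j<N. (cmod (a j))\<^sup>2)"
  define i1 where "i1 = (\<lambda>x. (cmod (f x))\<^sup>2 * r x)"
  define i2 where "i2 = (\<lambda>x. Re (f x * cnj (s x)))"
  define i3 where "i3 = (\<lambda>x. Re (dpsi x *\<^sub>R (s x * cnj (s x))))"
  have int1: "integrable leb i1"
  proof -
    obtain B where B: "\<And>x. x \<in> {-1..1} \<Longrightarrow> \<bar>r x\<bar> \<le> B"
      using compact_imp_bounded[OF compact_continuous_image[OF r_cont]] unfolding bounded_iff by fastforce
    show ?thesis unfolding i1_def
    proof (rule Bochner_Integration.integrable_bound)
      show "integrable leb (\<lambda>x. B * (cmod (f x))\<^sup>2)"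
        by (intro integrable_mult_right L2_integrable_sq f)
      show "(\<lambda>x. (cmod (f x))\<^sup>2 * r x) \<in> borel_measurable leb"
        by (intro borel_measurable_times borel_measurable_integrable[OF L2_integrable_sq[OF f]]
            borel_measurable_leb_continuous continuous_on_subset[OF r_cont]) auto
      show "AE x in leb. norm ((cmod (f x))\<^sup>2 * r x) \<le> norm (B * (cmod (f x))\<^sup>2)"
      proof (rule AE_I2)
        fix x assume "x \<in> space leb"
        then have "\<bar>r x\<bar> \<le> B" using B[of x] by auto
        then have "(cmod (f x))\<^sup>2 * \<bar>r x\<bar> \<le> (cmod (f x))\<^sup>2 * B" by (intro mult_left_mono) auto
        then show "norm ((cmod (f x))\<^sup>2 * r x) \<le> norm (B * (cmod (f x))\<^sup>2)"
          using \<open>\<bar>r x\<bar> \<le> B\<close> by (simp add: abs_mult mult.commute)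
      qed
    qed
  qed
  have sq: "complex_of_real ((cmod z)\<^sup>2 / pi) = of_real (1 / pi) * (z * cnj z)" for z
    by (simp only: of_real_divide complex_norm_square of_real_1) simp
  have inner: "L2_inner f s = of_real (b / pi)"
  proof -
    have "L2_inner f s = (\<Sum>j<N. cnj (of_real (1 / pi) * a j) * a j)"
      unfolding s_def[abs_def] a_def by (intro L2_inner_sum_right f ecis_L2)
    also have "\<dots> = (\<Sum>j<N. of_real ((cmod (a j))\<^sup>2 / pi))"
      unfolding sq by (intro sum.cong refl) (simp add: mult_ac)
    also have "\<dots> = of_real (b / pi)" by (simp add: b_def sum_divide_distrib)
    finally show ?thesis .
  qed
  have int2: "integrable leb i2" and I2: "(LINT x|leb. i2 x) = b / pi"
  proof -
    note i = L2_inner_integrable[OF f sL2]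
    show "integrable leb i2" unfolding i2_def by (rule integrable_Re[OF i])
    show "(LINT x|leb. i2 x) = b / pi"
      unfolding i2_def integral_Re[OF i] using inner by (simp add: L2_inner_def)
  qed
  have int3: "integrable leb i3" and I3: "(LINT x|leb. i3 x) = b / pi"
  proof -
    define c where "c j k = (of_real (1 / pi) * a j) * cnj (of_real (1 / pi) * a k)" for j k
    have eq: "dpsi x *\<^sub>R (s x * cnj (s x)) = (\<Sum>j<N. \<Sum>k<N. c j k * (dpsi x *\<^sub>R (ecis j x * cnj (ecis k x))))" for x
      unfolding s_def cnj_sum sum_product scaleR_sum_right c_def
      by (intro sum.cong refl) (simp add: scaleR_conv_of_real mult_ac)
    have i: "integrable leb (\<lambda>x. dpsi x *\<^sub>R (s x * cnj (s x)))"
      unfolding eq by (intro Bochner_Integration.integrable_sum integrable_mult_right ecis_orthogonal)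
    have "(LINT x|leb. dpsi x *\<^sub>R (s x * cnj (s x))) =
      (\<Sum>j<N. \<Sum>k<N. LINT x|leb. c j k * (dpsi x *\<^sub>R (ecis j x * cnj (ecis k x))))"
      unfolding eq
      by (subst Bochner_Integration.integral_sum, intro Bochner_Integration.integrable_sum integrable_mult_right ecis_orthogonal,
          intro sum.cong refl Bochner_Integration.integral_sum integrable_mult_right ecis_orthogonal)
    also have "\<dots> = (\<Sum>j<N. \<Sum>k<N. c j k * (if j = k then of_real pi else 0))"
      by (simp only: integral_mult_right_zero ecis_orthogonal)
    also have "\<dots> = (\<Sum>j<N. c j j * of_real pi)"
    proof (rule sum.cong[OF refl])
      fix j assume j: "j \<in> {..<N}"
      have "(\<Sum>k<N. c j k * (if j = k then of_real pi else 0)) = (\<Sum>k<N. if j = k then c j j * of_real pi else 0)"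
        by (intro sum.cong) auto
      also have "\<dots> = c j j * of_real pi" using j by simp
      finally show "(\<Sum>k<N. c j k * (if j = k then of_real pi else 0)) = c j j * of_real pi" .
    qed
    also have "\<dots> = (\<Sum>j<N. of_real ((cmod (a j))\<^sup>2 / pi))"
      unfolding sq by (intro sum.cong refl) (simp add: c_def mult_ac)
    also have "\<dots> = of_real (b / pi)" by (simp add: b_def sum_divide_distrib)
    finally have I: "(LINT x|leb. dpsi x *\<^sub>R (s x * cnj (s x))) = of_real (b / pi)" .
    show "integrable leb i3" unfolding i3_def by (rule integrable_Re[OF i])
    show "(LINT x|leb. i3 x) = b / pi" unfolding i3_def integral_Re[OF i] I by simp
  qed
  have "0 \<le> (LINT x|leb. i1 x - 2 * i2 x + i3 x)"
  proof (rule Bochner_Integration.integral_nonneg_AE[OF AE_I2])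
    fix x assume "x \<in> space leb"
    then have x: "x \<in> {-1<..<1}" by simp
    then have pos: "0 < cos_psi x" "0 < cos_phi x" using cos_psi_pos cos_phi_pos[of x] by auto
    have dr: "dpsi x * r x = 1" using pos theta_bounds sigma_bounds by (simp add: dpsi_def r_def)
    \<comment> \<open>Since \<open>r = 1 / dpsi\<close>, this is the expansion of the square.\<close>
    have "i1 x - 2 * i2 x + i3 x = dpsi x * (cmod (of_real (r x) * f x - s x))\<^sup>2"
    proof -
      have "dpsi x * (cmod (of_real (r x) * f x - s x))\<^sup>2 =
        (dpsi x * r x) * ((cmod (f x))\<^sup>2 * r x) - 2 * ((dpsi x * r x) * i2 x) + i3 x"
        unfolding i2_def i3_def cmod_power2 by (simp add: power2_eq_square algebra_simps)
      then show ?thesis unfolding dr i1_def by simp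
    qed
    also have "\<dots> \<ge> 0" using dpsi_nonneg[of x] x by auto
    finally show "0 \<le> i1 x - 2 * i2 x + i3 x" .
  qed
  also have "\<dots> = (LINT x|leb. i1 x) - b / pi"
    using int1 int2 int3 by (simp add: Bochner_Integration.integral_add Bochner_Integration.integral_diff I2 I3)
  finally have "b \<le> pi * (LINT x|leb. i1 x)" by (simp add: field_simps)
  then show ?thesis by (simp add: b_def i1_def r_def)
qed

lemma ecis_riemann_lebesgue:
  assumes f: "f \<in> L2"
  shows "(\<lambda>n. L2_inner f (ecis n)) \<longlonglongrightarrow> 0"
proof -
  have "summable (\<lambda>n. (cmod (L2_inner f (ecis n)))\<^sup>2)"
    by (rule summableI_nonneg_bounded[OF _ ecis_bessel[OF f]]) simp
  then have "(\<lambda>n. (cmod (L2_inner f (ecis n)))\<^sup>2) \<longlonglongrightarrow> 0" by (rule summable_LIMSEQ_zero)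
  then have "(\<lambda>n. sqrt ((cmod (L2_inner f (ecis n)))\<^sup>2)) \<longlonglongrightarrow> sqrt 0" by (rule tendsto_real_sqrt)
  then show ?thesis by (simp add: tendsto_norm_zero_iff)
qed

lemma trig_riemann_lebesgue:
  assumes f: "f \<in> L2"
  shows "(\<lambda>n. LINT x|leb. f x * of_real (ecos n x)) \<longlonglongrightarrow> 0"
    "(\<lambda>n. LINT x|leb. f x * of_real (esin n x)) \<longlonglongrightarrow> 0"
proof -
  have lim: "(\<lambda>n. LINT x|leb. f x * cnj (ecis n x)) \<longlonglongrightarrow> 0"
    using ecis_riemann_lebesgue[OF f] by (simp add: L2_inner_def)
  have "(\<lambda>n. cnj (L2_inner (\<lambda>x. cnj (f x)) (ecis n))) \<longlonglongrightarrow> cnj 0"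
    by (intro tendsto_cnj ecis_riemann_lebesgue L2_cnj f)
  also have "(\<lambda>n. cnj (L2_inner (\<lambda>x. cnj (f x)) (ecis n))) = (\<lambda>n. LINT x|leb. f x * ecis n x)"
    unfolding L2_inner_def by (subst Bochner_Integration.integral_cnj[symmetric]) simp
  finally have lim': "(\<lambda>n. LINT x|leb. f x * ecis n x) \<longlonglongrightarrow> 0" by simp
  have i: "integrable leb (\<lambda>x. f x * ecis n x)" "integrable leb (\<lambda>x. f x * cnj (ecis n x))" for n
    by (intro L2_mult_integrable f ecis_L2 L2_cnj)+
  have "(LINT x|leb. f x * of_real (ecos n x)) =
      (1/2) * (LINT x|leb. f x * ecis n x) + (1/2) * (LINT x|leb. f x * cnj (ecis n x))" for n
  proof -
    have "f x * of_real (ecos n x) = (1/2) * (f x * ecis n x) + (1/2) * (f x * cnj (ecis n x))" for x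
      by (simp add: ecos_def ecis_def complex_eq_iff field_simps)
    then show ?thesis using i by (simp add: Bochner_Integration.integral_add)
  qed
  then show "(\<lambda>n. LINT x|leb. f x * of_real (ecos n x)) \<longlonglongrightarrow> 0"
    using tendsto_add[OF tendsto_mult_right_zero[OF lim', of "1/2"] tendsto_mult_right_zero[OF lim, of "1/2"]] by simp
  have "(LINT x|leb. f x * of_real (esin n x)) =
      (-\<i>/2) * (LINT x|leb. f x * ecis n x) + (\<i>/2) * (LINT x|leb. f x * cnj (ecis n x))" for n
  proof -
    have "f x * of_real (esin n x) = (-\<i>/2) * (f x * ecis n x) + (\<i>/2) * (f x * cnj (ecis n x))" for x
      by (simp add: esin_def ecis_def complex_eq_iff field_simps)
    then show ?thesis using i
      by (subst Bochner_Integration.integral_mult_right_zero[symmetric])+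
         (simp only:, intro Bochner_Integration.integral_add integrable_mult_right i)
  qed
  then show "(\<lambda>n. LINT x|leb. f x * of_real (esin n x)) \<longlonglongrightarrow> 0"
    using tendsto_add[OF tendsto_mult_right_zero[OF lim', of "-\<i>/2"] tendsto_mult_right_zero[OF lim, of "\<i>/2"]] by simp
qed

section \<open>Localization\<close>

text \<open>The kernel is applied to a function that vanishes near the points \<open>y\<close>. No condition is imposed at
  the points \<open>-y\<close>.\<close>

lemma Ker_localization:
  assumes f: "f \<in> L2" and S: "compact S" "S \<subseteq> {-1..1}" and K: "compact K" "K \<subseteq> {-1<..<1}" "K \<inter> S = {}"
    and f0: "\<And>x. x \<in> {-1<..<1} - S \<Longrightarrow> f x = 0"
  shows "uniform_limit K (\<lambda>m y. LINT x|leb. f x * of_real (Ker m y x)) (\<lambda>_. 0) sequentially"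
proof -
  have ps1: "continuous_on (K \<times> S) (\<lambda>p. psi (fst p))" and ps2: "continuous_on (K \<times> S) (\<lambda>p. psi (snd p))"
    by (rule continuous_on_compose2[OF continuous_on_psi]; use K S in \<open>fastforce intro!: continuous_intros\<close>)+
  have cp1: "continuous_on (K \<times> S) (\<lambda>p. cos_phi (fst p))" and cp2: "continuous_on (K \<times> S) (\<lambda>p. cos_phi (snd p))"
    by (rule continuous_on_compose2[OF continuous_on_cos_phi]; auto intro!: continuous_intros)+
  have cos_psi_squared: "continuous_on (K \<times> S) (\<lambda>p. cos_psi (snd p))"
    unfolding cos_psi_def by (intro continuous_intros ps2)
  have ne: "sin (psi (snd p) - psi (fst p)) \<noteq> 0" "1 + cos (psi (snd p) + psi (fst p)) \<noteq> 0" "cos_phi (snd p) + cos_phi (fst p) \<noteq> 0"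
    if "p \<in> K \<times> S" for p
  proof -
    have y: "fst p \<in> {-1<..<1}" and x: "snd p \<in> {-1..1}" and "snd p \<noteq> fst p" using that K S by auto
    then show "sin (psi (snd p) - psi (fst p)) \<noteq> 0" by (intro sin_psi_diff_nonzero)
    show "1 + cos (psi (snd p) + psi (fst p)) \<noteq> 0" using cos_psi_add_pos[OF x y] by simp
    have "fst p \<in> {-1..1}" using y by auto
    then show "cos_phi (snd p) + cos_phi (fst p) \<noteq> 0" using cos_phi_pos[OF x] cos_phi_pos[of "fst p"] by simp
  qed
  have coeff_diff: "continuous_on (K \<times> S) (\<lambda>p. coeff_diff (fst p) (snd p))"
    unfolding coeff_diff_def by (intro continuous_intros ps1 ps2 cp1 cp2 cos_psi_squared ballI ne)
  have coeff_sum: "continuous_on (K \<times> S) (\<lambda>p. coeff_sum (fst p) (snd p))"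
    unfolding coeff_sum_def by (intro continuous_intros ps1 ps2 cp1 cp2 cos_psi_squared ballI ne)
  define k1 where "k1 y x = cos_psi x * cos_phi x" for y x :: real
  define k2 where "k2 y x = (coeff_sum y x - coeff_diff y x) / 2" for y x
  define k3 where "k3 y x = (coeff_diff y x + coeff_sum y x) / 2" for y x
  have k1: "continuous_on (K \<times> S) (\<lambda>(y, x). k1 y x)"
    unfolding k1_def split_def by (intro continuous_intros cos_psi_squared cp2)
  have k2: "continuous_on (K \<times> S) (\<lambda>(y, x). k2 y x)"
    unfolding k2_def split_def by (intro continuous_intros coeff_diff coeff_sum) auto
  have k3: "continuous_on (K \<times> S) (\<lambda>(y, x). k3 y x)"
    unfolding k3_def split_def by (intro continuous_intros coeff_diff coeff_sum) auto
  have esin_meas: "esin n \<in> borel_measurable leb" for n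
    unfolding esin_def[abs_def] by (rule measurable_comp_psi) (intro continuous_intros)
  have esin_le: "\<bar>esin n x\<bar> \<le> 1" for n x by (simp add: esin_def)
  note lim_cos = uniform_oscillatory_limit[OF f K(1) S(1) _ f0 measurable_ecos ecos_le_1 trig_riemann_lebesgue(1)]
  note lim_sin = uniform_oscillatory_limit[OF f K(1) S(1) _ f0 esin_meas esin_le trig_riemann_lebesgue(2)]
  define J1 where "J1 m y = (LINT x|leb. f x * of_real (k1 y x * ecos m x))" for m y
  define J2 where "J2 m y = (LINT x|leb. f x * of_real (k2 y x * ecos m x))" for m y
  define J3 where "J3 m y = (LINT x|leb. f x * of_real (k3 y x * esin m x))" for m y
  have J: "uniform_limit K J1 (\<lambda>_. 0) sequentially" "uniform_limit K J2 (\<lambda>_. 0) sequentially"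
    "uniform_limit K J3 (\<lambda>_. 0) sequentially"
    unfolding J1_def J2_def J3_def using lim_cos[OF k1] lim_cos[OF k2] lim_sin[OF k3] by auto
  have int: "integrable leb (\<lambda>x. f x * of_real (k y x * e x))"
    if "continuous_on (K \<times> S) (\<lambda>(y, x). k y x)" "y \<in> K" "e \<in> borel_measurable leb" "\<And>x. \<bar>e x\<bar> \<le> 1"
    for k :: "real \<Rightarrow> real \<Rightarrow> real" and e y
  proof -
    have "continuous_on S (\<lambda>x. (\<lambda>(y, x). k y x) (y, x))"
      by (rule continuous_on_compose2[OF that(1) continuous_on_Pair[OF continuous_on_const continuous_on_id]])
         (use that(2) in auto)
    then have "continuous_on S (k y)" by simp
    then have "(\<lambda>x. of_real (k y x) * f x) \<in> L2"
      by (rule L2_mult_continuous_support[OF f S(1) _ f0])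
    moreover have "(\<lambda>x. complex_of_real (e x)) \<in> L2"
      by (rule L2_bounded[where B = 1]) (use that in \<open>auto intro!: borel_measurable_of_real\<close>)
    ultimately have "integrable leb (\<lambda>x. (of_real (k y x) * f x) * of_real (e x))"
      by (rule L2_mult_integrable)
    then show ?thesis by (simp add: mult_ac)
  qed
  have expand: "(LINT x|leb. f x * of_real (Ker m y x)) =
      of_real (ecos m y) * J1 m y + of_real (esin m y) * J2 m y + of_real (ecos m y) * J3 m y"
    if y: "y \<in> K" for m y
  proof -
    have "(LINT x|leb. f x * of_real (Ker m y x)) =
      (LINT x|leb. of_real (ecos m y) * (f x * of_real (k1 y x * ecos m x)) +
         of_real (esin m y) * (f x * of_real (k2 y x * ecos m x)) +
         of_real (ecos m y) * (f x * of_real (k3 y x * esin m x)))"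
    proof (rule Bochner_Integration.integral_cong[OF refl])
      fix x assume "x \<in> space leb"
      then have x: "x \<in> {-1<..<1}" by simp
      show "f x * of_real (Ker m y x) = of_real (ecos m y) * (f x * of_real (k1 y x * ecos m x)) +
         of_real (esin m y) * (f x * of_real (k2 y x * ecos m x)) +
         of_real (ecos m y) * (f x * of_real (k3 y x * esin m x))"
      proof (cases "x \<in> S")
        case True
        then have "x \<noteq> y" "x \<in> {-1..1}" "y \<in> {-1<..<1}" using y K S by auto
        then have "Ker m y x = ecos m y * (k1 y x * ecos m x) + esin m y * (k2 y x * ecos m x) + ecos m y * (k3 y x * esin m x)"
          unfolding k1_def k2_def k3_def by (intro Ker_expansion')
        then show ?thesis by (simp add: algebra_simps)
      qed (use f0 x in auto)
    qed
    also have "\<dots> = of_real (ecos m y) * J1 m y + of_real (esin m y) * J2 m y + of_real (ecos m y) * J3 m y"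
      unfolding J1_def J2_def J3_def
      by (simp only: Bochner_Integration.integral_add Bochner_Integration.integrable_add integrable_mult_right
            integral_mult_right_zero int[OF k1 y measurable_ecos ecos_le_1] int[OF k2 y measurable_ecos ecos_le_1]
            int[OF k3 y esin_meas esin_le])
    finally show ?thesis .
  qed
  show ?thesis
  proof (rule uniform_limitI)
    fix \<epsilon> :: real assume \<epsilon>: "\<epsilon> > 0"
    have "\<forall>\<^sub>F m in sequentially. \<forall>y\<in>K. dist (J1 m y) 0 < \<epsilon> / 3"
      "\<forall>\<^sub>F m in sequentially. \<forall>y\<in>K. dist (J2 m y) 0 < \<epsilon> / 3"
      "\<forall>\<^sub>F m in sequentially. \<forall>y\<in>K. dist (J3 m y) 0 < \<epsilon> / 3"
      using \<epsilon> by (intro uniform_limitD[OF J(1)] uniform_limitD[OF J(2)] uniform_limitD[OF J(3)]; simp)+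
    then show "\<forall>\<^sub>F m in sequentially. \<forall>y\<in>K. dist (LINT x|leb. f x * of_real (Ker m y x)) 0 < \<epsilon>"
    proof eventually_elim
      case (elim m)
      show ?case
      proof
        fix y assume y: "y \<in> K"
        have le: "cmod (of_real c * z) \<le> cmod z" if "\<bar>c\<bar> \<le> 1" for c z
          using mult_right_mono[OF that norm_ge_zero[of z]] by (simp add: norm_mult)
        have "cmod (LINT x|leb. f x * of_real (Ker m y x)) \<le>
          cmod (of_real (ecos m y) * J1 m y) + cmod (of_real (esin m y) * J2 m y) + cmod (of_real (ecos m y) * J3 m y)"
          unfolding expand[OF y] by (intro order_trans[OF norm_triangle_ineq] add_mono norm_triangle_ineq order_refl)
        also have "\<dots> \<le> cmod (J1 m y) + cmod (J2 m y) + cmod (J3 m y)"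
          by (intro add_mono le ecos_le_1 esin_le)
        also have "\<dots> < \<epsilon> / 3 + \<epsilon> / 3 + \<epsilon> / 3"
          using elim y by (intro add_strict_mono) auto
        finally show "dist (LINT x|leb. f x * of_real (Ker m y x)) 0 < \<epsilon>" by simp
      qed
    qed
  qed
qed


lemma lam_orth_proj:
  fixes n :: nat
  assumes f: "f \<in> L2" and y: "y \<in> {-1<..<1}"
  defines "p \<equiv> orth_proj T (2 * n + 1) f"
  shows "of_real (lam y) * p y = (LINT x|leb. f x * of_real (Ker (Suc n) y x))
      - (LINT x|leb. (f x - p x) * of_real (Ker (Suc n) y x - trimmed_ker n y x))"
proof -
  note pp = orth_proj_props[OF f, where n = n, folded p_def]
  have pL2: "p \<in> L2" by (rule trig_space_L2[OF pp(1)])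
  have fp: "(\<lambda>x. f x - p x) \<in> L2" by (rule L2_diff[OF f pL2])
  have tL2: "(\<lambda>x. complex_of_real (trimmed_ker n y x)) \<in> L2"
    by (intro L2_continuous continuous_intros continuous_on_trimmed_ker)
  obtain q where q: "q \<in> trig_space T (2 * n + 1)" "\<forall>x\<in>{-1..1}. q x = of_real (trimmed_ker n y x)"
    using trimmed_ker_in_trig_space by blast
  have "(LINT x|leb. (f x - p x) * of_real (trimmed_ker n y x)) = L2_inner (\<lambda>x. f x - p x) q"
    unfolding L2_inner_def using q(2) by (intro Bochner_Integration.integral_cong) auto
  also have "\<dots> = 0" by (rule pp(2)[OF q(1)])
  finally have 0: "(LINT x|leb. (f x - p x) * of_real (trimmed_ker n y x)) = 0" .
  have "(LINT x|leb. (f x - p x) * of_real (Ker (Suc n) y x - trimmed_ker n y x)) =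
      (LINT x|leb. (f x - p x) * of_real (Ker (Suc n) y x) - (f x - p x) * of_real (trimmed_ker n y x))"
    by (simp add: algebra_simps)
  also have "\<dots> = (LINT x|leb. (f x - p x) * of_real (Ker (Suc n) y x))"
    by (subst Bochner_Integration.integral_diff) (intro L2_mult_integrable fp Ker_L2 tL2 | simp add: 0)+
  also have "\<dots> = (LINT x|leb. f x * of_real (Ker (Suc n) y x) - p x * of_real (Ker (Suc n) y x))"
    by (simp add: left_diff_distrib)
  also have "\<dots> = (LINT x|leb. f x * of_real (Ker (Suc n) y x)) - (LINT x|leb. p x * of_real (Ker (Suc n) y x))"
    by (intro Bochner_Integration.integral_diff L2_mult_integrable f pL2 Ker_L2)
  also have "(LINT x|leb. p x * of_real (Ker (Suc n) y x)) = of_real (lam y) * p y"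
    by (rule Ker_reproduces[OF pp(1)]) (use y in auto)
  finally show ?thesis by simp
qed

lemma orth_proj_local_limit:
  assumes f: "f \<in> L2" and K: "compact K" "K \<subseteq> {-1<..<1}"
    and loc: "uniform_limit K (\<lambda>m y. LINT x|leb. f x * of_real (Ker m y x)) (\<lambda>_. 0) sequentially"
  shows "uniform_limit K (\<lambda>n. orth_proj T (2 * n + 1) f) (\<lambda>_. 0) sequentially"
proof (cases "K = {}")
  case False
  \<comment> \<open>The point of \<open>K\<close> nearest to \<open>\<plusminus>1\<close> gives the smallest \<open>lam\<close> and the largest error bound.\<close>
  have "continuous_on K cos_psi" by (rule continuous_on_subset[OF continuous_on_cos_psi]) (use K in auto)
  then obtain z where z: "z \<in> K" "\<And>y. y \<in> K \<Longrightarrow> cos_psi z \<le> cos_psi y"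
    using continuous_attains_inf[OF K(1) False] by blast
  have cz: "0 < cos_psi z" using z K cos_psi_pos by auto
  define B where "B = 2 / cos_psi z + 2 / cos theta + 4"
  have B0: "0 < B" using cz cos_theta_pos by (simp add: B_def add_pos_pos)
  have lz: "0 < lam z" using z K lam_pos by auto
  have lam: "lam z \<le> lam y" if "y \<in> K" for y
    using z(2)[OF that] cz sigma_bounds theta_bounds by (auto simp: lam_def intro!: mult_left_mono power_mono divide_right_mono)
  show ?thesis
  proof (rule uniform_limitI)
    fix \<epsilon> :: real assume \<epsilon>: "\<epsilon> > 0"
    define \<delta> where "\<delta> = lam z * \<epsilon> / (4 * B)"
    have \<delta>: "\<delta> > 0" using \<epsilon> lz B0 by (simp add: \<delta>_def)
    have "\<forall>\<^sub>F n in sequentially. sqnorm (\<lambda>x. f x - orth_proj T (2 * n + 1) f x) < \<delta>\<^sup>2"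
      using order_tendstoD(2)[OF orth_proj_converges[OF f], of "\<delta>\<^sup>2"] \<delta> by simp
    moreover have "\<forall>\<^sub>F n in sequentially. \<forall>y\<in>K. dist (LINT x|leb. f x * of_real (Ker (Suc n) y x)) 0 < lam z * \<epsilon> / 2"
      using uniform_limitD[OF loc, of "lam z * \<epsilon> / 2"] \<epsilon> lz
      by (subst eventually_sequentially_Suc) simp
    ultimately show "\<forall>\<^sub>F n in sequentially. \<forall>y\<in>K. dist (orth_proj T (2 * n + 1) f y) 0 < \<epsilon>"
    proof eventually_elim
      case (elim n)
      define p where "p = orth_proj T (2 * n + 1) f"
      have pL2: "p \<in> L2" unfolding p_def by (rule trig_space_L2[OF orth_proj_props(1)[OF f]])
      show ?case
      proof
        fix y assume y: "y \<in> K"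
        then have y1: "y \<in> {-1<..<1}" using K by auto
        have "cmod (LINT x|leb. (f x - p x) * of_real (Ker (Suc n) y x - trimmed_ker n y x)) \<le> 2 * B * \<delta>"
        proof (rule integral_mult_bounded_small)
          show "(\<lambda>x. f x - p x) \<in> L2" by (rule L2_diff[OF f pL2])
          show "sqnorm (\<lambda>x. f x - p x) \<le> \<delta>\<^sup>2" using elim(1) by (simp add: p_def)
          show "(\<lambda>x. complex_of_real (Ker (Suc n) y x - trimmed_ker n y x)) \<in> borel_measurable leb"
            by (rule L2_measurable, intro L2_continuous continuous_intros continuous_on_Ker continuous_on_trimmed_ker)
          fix x :: real assume "x \<in> {-1<..<1}"
          then have "\<bar>Ker (Suc n) y x - trimmed_ker n y x\<bar> \<le> 2 / cos_psi y + 2 / cos theta + 4"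
            by (intro Ker_minus_trimmed_ker_bounded y1) auto
          also have "\<dots> \<le> B" unfolding B_def using z(2)[OF y] cz by (auto intro!: divide_left_mono)
          finally show "cmod (of_real (Ker (Suc n) y x - trimmed_ker n y x)) \<le> B" by (simp only: norm_of_real)
        qed (rule \<delta>)
        also have "2 * B * \<delta> = lam z * \<epsilon> / 2" using B0 by (simp add: \<delta>_def)
        finally have 1: "cmod (LINT x|leb. (f x - p x) * of_real (Ker (Suc n) y x - trimmed_ker n y x)) \<le> lam z * \<epsilon> / 2" .
        have 2: "cmod (LINT x|leb. f x * of_real (Ker (Suc n) y x)) < lam z * \<epsilon> / 2" using elim(2) y by simp
        have "lam y * cmod (p y) = cmod (of_real (lam y) * p y)"
          using lam_pos[OF y1] by (simp add: norm_mult)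
        also have "\<dots> < lam z * \<epsilon>"
          unfolding lam_orth_proj[OF f y1, of n, folded p_def]
          using norm_triangle_ineq4[of "LINT x|leb. f x * of_real (Ker (Suc n) y x)"
              "LINT x|leb. (f x - p x) * of_real (Ker (Suc n) y x - trimmed_ker n y x)"] 1 2 by linarith
        also have "\<dots> \<le> lam y * \<epsilon>" using lam[OF y] \<epsilon> by (intro mult_right_mono) auto
        finally have "cmod (p y) < \<epsilon>" using lam_pos[OF y1] by simp
        then show "dist (orth_proj T (2 * n + 1) f y) 0 < \<epsilon>" by (simp add: p_def)
      qed
    qed
  qed
qed simp

end

theorem theorem6p1:
  fixes T a b c d :: real and f :: "real \<Rightarrow> complex"
  assumes "T > 1"
    and "f \<in> L2"
    and "{a..b} \<subseteq> {-1..1}"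
    and "AE x\<in>{a..b} in lebesgue. f x = 0"
    and "{c..d} \<subseteq> {a<..<b}"
  shows "uniform_limit {c..d} (\<lambda>n. orth_proj T (2 * n + 1) f) (\<lambda>x. 0) sequentially"
proof (cases "c \<le> d")
  case True
  interpret fourier_extension T by unfold_locales (rule assms(1))
  have "c \<in> {a<..<b}" "d \<in> {a<..<b}" using True assms(5) by auto
  then have cd: "a < c" "d < b" and ab: "-1 \<le> a" "b \<le> 1" using True assms(3) by auto
  define S where "S = {-1..a} \<union> {b..1}"
  define g where "g x = (if x \<in> S then f x else 0)" for x
  \<comment> \<open>Here \<open>g\<close> vanishes everywhere on \<open>(a,b)\<close>, whereas \<open>f\<close> does so only almost everywhere.\<close>
  have "AE x in lebesgue. x \<in> {-1<..<1} \<longrightarrow> g x = f x"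
    using assms(4) by (rule eventually_mono) (auto simp: g_def S_def)
  then have gf: "AE x in leb. g x = f x"
    by (subst AE_restrict_space_iff) auto
  have "(\<lambda>x. of_real (indicator S x) * f x) \<in> L2"
  proof (rule L2_bounded_mult[OF assms(2), where B = 1])
    have "(indicator S :: real \<Rightarrow> real) \<in> borel_measurable lebesgue"
      by (intro borel_measurable_indicator) (simp add: S_def)
    then have "(indicator S :: real \<Rightarrow> real) \<in> borel_measurable leb"
      by (rule measurable_restrict_space1)
    then show "(\<lambda>x. complex_of_real (indicator S x)) \<in> borel_measurable leb"
      by measurable
  qed (simp add: indicator_def)
  then have g: "g \<in> L2"
    by (rule L2_cong) (simp add: g_def)
  have "uniform_limit {c..d} (\<lambda>m y. LINT x|leb. g x * of_real (Ker m y x)) (\<lambda>_. 0) sequentially"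
    by (rule Ker_localization[OF g, of S]) (use ab cd True in \<open>auto simp: S_def g_def\<close>)
  also have "(\<lambda>m y. LINT x|leb. g x * of_real (Ker m y x)) = (\<lambda>m y. LINT x|leb. f x * of_real (Ker m y x))"
  proof (intro ext integral_cong_AE)
    fix m y
    show "(\<lambda>x. g x * of_real (Ker m y x)) \<in> borel_measurable leb"
      "(\<lambda>x. f x * of_real (Ker m y x)) \<in> borel_measurable leb"
      by (intro borel_measurable_integrable L2_mult_integrable g assms(2) Ker_L2)+
    show "AE x in leb. g x * of_real (Ker m y x) = f x * of_real (Ker m y x)"
      using gf by (rule eventually_mono) simp
  qed
  finally show ?thesis
    by (intro orth_proj_local_limit assms(2)) (use ab cd True in auto)
qed simp

end
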